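(* Let $M$ be a compact Riemannian manifold of dimension $n\ge3$, let $\varphi_\lambda$ be a Laplace eigenfunction on $M$, $-\Delta\varphi_\lambda=\lambda\varphi_\lambda$, and let $p\in M$ lie at the intersection of two nodal hypersurfaces $M_1,M_2$ of $\varphi_\lambda$. Let $\eta_1,\eta_2\in S^{n-1}$ be two unit normal vectors to $M_1$ and $M_2$, respectively, at $p$. If the order of vanishing of $\varphi_\lambda$ at $p$ is $n_0$, then the angle between $M_1$ and $M_2$ at $p$ satisfies $$\arccos\langle\eta_1,\eta_2\rangle\in P,\qquad P=\left\{\frac{a}{b}\pi:\ b=1,2,\dots,n_0,\ a=0,1,\dots,b\right\}.$$
   Context: A nodal hypersurface of $\varphi_\lambda$ is a smooth hypersurface contained in the nodal set $\{x\in M:\varphi_\lambda(x)=0\}$. $S^{n-1}$ is identified with the unit sphere of $T_pM$ (normal coordinates at $p$). The order of vanishing of $\varphi_\lambda$ at $p$ is the degree of the lowest-order non-zero homogeneous term in the Taylor expansion of $\varphi_\lambda$ at $p$. *)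

theory Defs
  imports "HOL-Analysis.Analysis"
begin

section \<open>Smooth functions between normed spaces\<close>

text \<open>The following two notions are only used on open sets \<open>S\<close>.\<close>

primrec Ck_on :: "nat \<Rightarrow> 'a::real_normed_vector set \<Rightarrow> ('a \<Rightarrow> 'b::real_normed_vector) \<Rightarrow> bool" where
  "Ck_on 0 S f \<longleftrightarrow> continuous_on S f"
| "Ck_on (Suc k) S f \<longleftrightarrow>
     (\<forall>x\<in>S. f differentiable (at x)) \<and> (\<forall>v. Ck_on k S (\<lambda>x. frechet_derivative f (at x) v))"

definition smooth_on :: "'a::real_normed_vector set \<Rightarrow> ('a \<Rightarrow> 'b::real_normed_vector) \<Rightarrow> bool" where
  "smooth_on S f \<longleftrightarrow> (\<forall>k. Ck_on k S f)"

definition partial :: "'n \<Rightarrow> (real^'n \<Rightarrow> real) \<Rightarrow> real^'n \<Rightarrow> real" where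
  "partial i F x = frechet_derivative F (at x) (axis i 1)"

text \<open>The homogeneous term of degree \<open>k\<close> of the Taylor expansion of \<open>F\<close> at \<open>x\<close>, as a function of
  the increment \<open>h\<close>.\<close>

definition taylor_term :: "nat \<Rightarrow> (real^'n \<Rightarrow> real) \<Rightarrow> real^'n \<Rightarrow> real^'n \<Rightarrow> real" where
  "taylor_term k F x h = (deriv ^^ k) (\<lambda>t. F (x + t *\<^sub>R h)) 0 / fact k"


section \<open>Smooth manifolds\<close>

text \<open>A chart is a pair \<open>(U, \<phi>)\<close>; the values of \<open>\<phi>\<close> outside \<open>U\<close> are irrelevant. The dimension of
  the manifold is the cardinality of the index type \<open>'n\<close>.\<close>

type_synonym ('m, 'n) chart = "'m set \<times> ('m \<Rightarrow> (real, 'n) vec)"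

definition param :: "('m, 'n) chart \<Rightarrow> real^'n \<Rightarrow> 'm" where
  "param c = inv_into (fst c) (snd c)"

definition is_chart :: "'m topology \<Rightarrow> ('m, 'n::finite) chart \<Rightarrow> bool" where
  "is_chart X c \<longleftrightarrow>
     openin X (fst c) \<and> open (snd c ` fst c) \<and>
     homeomorphic_map (subtopology X (fst c)) (top_of_set (snd c ` fst c)) (snd c)"

definition smooth_transition :: "('m, 'n::finite) chart \<Rightarrow> ('m, 'n) chart \<Rightarrow> bool" where
  "smooth_transition c d \<longleftrightarrow> smooth_on (snd c ` (fst c \<inter> fst d)) (snd d \<circ> param c)"

definition compatible :: "('m, 'n::finite) chart \<Rightarrow> ('m, 'n) chart \<Rightarrow> bool" where
  "compatible c d \<longleftrightarrow> smooth_transition c d \<and> smooth_transition d c"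

text \<open>A smooth manifold without boundary: \<open>A\<close> is a maximal smooth atlas. Connectedness is not
  required.\<close>

definition smooth_manifold :: "'m topology \<Rightarrow> ('m, 'n::finite) chart set \<Rightarrow> bool" where
  "smooth_manifold X A \<longleftrightarrow>
     Hausdorff_space X \<and> second_countable X \<and>
     (\<forall>c\<in>A. is_chart X c) \<and> (\<Union>c\<in>A. fst c) = topspace X \<and>
     (\<forall>c\<in>A. \<forall>d\<in>A. compatible c d) \<and>
     (\<forall>c. is_chart X c \<and> (\<forall>d\<in>A. compatible c d) \<longrightarrow> c \<in> A)"

definition smooth_fun_on :: "('m, 'n::finite) chart set \<Rightarrow> 'm set \<Rightarrow> ('m \<Rightarrow> real) \<Rightarrow> bool" where
  "smooth_fun_on A W f \<longleftrightarrow> (\<forall>c\<in>A. smooth_on (snd c ` (fst c \<inter> W)) (f \<circ> param c))"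

definition smooth_fun_at :: "'m topology \<Rightarrow> ('m, 'n::finite) chart set \<Rightarrow> 'm \<Rightarrow> ('m \<Rightarrow> real) \<Rightarrow> bool" where
  "smooth_fun_at X A p f \<longleftrightarrow> (\<exists>W. openin X W \<and> p \<in> W \<and> smooth_fun_on A W f)"

definition smooth_curve_at :: "'m topology \<Rightarrow> ('m, 'n::finite) chart set \<Rightarrow> 'm \<Rightarrow> (real \<Rightarrow> 'm) \<Rightarrow> bool" where
  "smooth_curve_at X A p \<gamma> \<longleftrightarrow> \<gamma> 0 = p \<and>
     (\<exists>e>0. continuous_map (top_of_set {-e<..<e}) X \<gamma> \<and>
       (\<forall>c\<in>A. smooth_on {t \<in> {-e<..<e}. \<gamma> t \<in> fst c} (snd c \<circ> \<gamma>)))"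


section \<open>Tangent vectors\<close>

text \<open>Tangent vectors at \<open>p\<close> are velocities of smooth curves through \<open>p\<close>, seen as operators on
  functions smooth near \<open>p\<close>. Functions that are not smooth near \<open>p\<close> are sent to 0, so that two curves
  have the same velocity iff they have the same derivative in coordinates. The vector space
  operations on the tangent space are the pointwise ones.\<close>

type_synonym 'm tvec = "('m \<Rightarrow> real) \<Rightarrow> real"

definition velocity :: "'m topology \<Rightarrow> ('m, 'n::finite) chart set \<Rightarrow> (real \<Rightarrow> 'm) \<Rightarrow> 'm tvec" where
  "velocity X A \<gamma> = (\<lambda>f. if smooth_fun_at X A (\<gamma> 0) f then deriv (f \<circ> \<gamma>) 0 else 0)"

definition tangent_space :: "'m topology \<Rightarrow> ('m, 'n::finite) chart set \<Rightarrow> 'm \<Rightarrow> 'm tvec set" where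
  "tangent_space X A p = {velocity X A \<gamma> | \<gamma>. smooth_curve_at X A p \<gamma>}"

text \<open>The coordinate vector \<open>\<partial>\<^sub>i\<close> of the chart \<open>c\<close> at the point with coordinates \<open>x\<close>.\<close>

definition coord_vec ::
    "'m topology \<Rightarrow> ('m, 'n::finite) chart set \<Rightarrow> ('m, 'n) chart \<Rightarrow> 'n \<Rightarrow> real^'n \<Rightarrow> 'm tvec" where
  "coord_vec X A c i x = velocity X A (\<lambda>t. param c (x + t *\<^sub>R axis i 1))"


section \<open>Riemannian metrics and the Laplace--Beltrami operator\<close>

type_synonym 'm metric = "'m \<Rightarrow> 'm tvec \<Rightarrow> 'm tvec \<Rightarrow> real"

definition metric_matrix ::
    "'m topology \<Rightarrow> ('m, 'n::finite) chart set \<Rightarrow> 'm metric \<Rightarrow> ('m, 'n) chart \<Rightarrow> real^'n \<Rightarrow> real^'n^'n" where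
  "metric_matrix X A g c x =
     (\<chi> i j. g (param c x) (coord_vec X A c i x) (coord_vec X A c j x))"

definition inner_product_on :: "'m tvec set \<Rightarrow> ('m tvec \<Rightarrow> 'm tvec \<Rightarrow> real) \<Rightarrow> bool" where
  "inner_product_on T b \<longleftrightarrow>
     (\<forall>u\<in>T. \<forall>v\<in>T. b u v = b v u) \<and>
     (\<forall>u\<in>T. \<forall>v\<in>T. \<forall>w\<in>T. b (\<lambda>f. u f + v f) w = b u w + b v w) \<and>
     (\<forall>r. \<forall>u\<in>T. \<forall>v\<in>T. b (\<lambda>f. r * u f) v = r * b u v) \<and>
     (\<forall>u\<in>T. u \<noteq> (\<lambda>f. 0) \<longrightarrow> b u u > 0)"

definition riemannian_manifold ::
    "'m topology \<Rightarrow> ('m, 'n::finite) chart set \<Rightarrow> 'm metric \<Rightarrow> bool" where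
  "riemannian_manifold X A g \<longleftrightarrow>
     smooth_manifold X A \<and>
     (\<forall>p\<in>topspace X. inner_product_on (tangent_space X A p) (g p)) \<and>
     (\<forall>c\<in>A. \<forall>i j. smooth_on (snd c ` fst c) (\<lambda>x. metric_matrix X A g c x $ i $ j))"

text \<open>In the coordinates of \<open>c\<close>,
  \<open>\<Delta>f = |G|\<^sup>-\<^sup>1\<^sup>/\<^sup>2 \<Sum>\<^sub>i \<partial>\<^sub>i (|G|\<^sup>1\<^sup>/\<^sup>2 \<Sum>\<^sub>j G\<^sup>i\<^sup>j \<partial>\<^sub>j f)\<close> with \<open>|G|\<close> the determinant of the metric
  matrix and \<open>G\<^sup>i\<^sup>j\<close> the entries of its inverse.\<close>

definition laplacian_in_chart ::
    "'m topology \<Rightarrow> ('m, 'n::finite) chart set \<Rightarrow> 'm metric \<Rightarrow> ('m, 'n) chart \<Rightarrow>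
     ('m \<Rightarrow> real) \<Rightarrow> real^'n \<Rightarrow> real" where
  "laplacian_in_chart X A g c f x =
     (let G = metric_matrix X A g c; w = (\<lambda>y. sqrt (det (G y))) in
      (\<Sum>i\<in>UNIV. partial i
         (\<lambda>y. w y * (\<Sum>j\<in>UNIV. matrix_inv (G y) $ i $ j * partial j (f \<circ> param c) y)) x) / w x)"

text \<open>The Laplacian of a smooth function does not depend on the chart; here \<open>h\<close> is \<open>\<Delta>f\<close>.\<close>

definition has_laplacian ::
    "'m topology \<Rightarrow> ('m, 'n::finite) chart set \<Rightarrow> 'm metric \<Rightarrow> ('m \<Rightarrow> real) \<Rightarrow> ('m \<Rightarrow> real) \<Rightarrow> bool" where
  "has_laplacian X A g f h \<longleftrightarrow>
     (\<forall>c\<in>A. \<forall>q\<in>fst c. h q = laplacian_in_chart X A g c f (snd c q))"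

definition laplace_eigenfunction ::
    "'m topology \<Rightarrow> ('m, 'n::finite) chart set \<Rightarrow> 'm metric \<Rightarrow> real \<Rightarrow> ('m \<Rightarrow> real) \<Rightarrow> bool" where
  "laplace_eigenfunction X A g lam f \<longleftrightarrow>
     smooth_fun_on A (topspace X) f \<and> (\<exists>q\<in>topspace X. f q \<noteq> 0) \<and>
     has_laplacian X A g f (\<lambda>q. - lam * f q)"

text \<open>The order of vanishing can be read off in any chart around \<open>p\<close>.\<close>

definition vanishing_order ::
    "('m, 'n::finite) chart set \<Rightarrow> ('m \<Rightarrow> real) \<Rightarrow> 'm \<Rightarrow> nat \<Rightarrow> bool" where
  "vanishing_order A f p k \<longleftrightarrow>
     (\<exists>c\<in>A. p \<in> fst c \<and>
       (\<exists>h. taylor_term k (f \<circ> param c) (snd c p) h \<noteq> 0) \<and>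
       (\<forall>j<k. \<forall>h. taylor_term j (f \<circ> param c) (snd c p) h = 0))"


section \<open>Nodal hypersurfaces and their normals\<close>

text \<open>An embedded submanifold of codimension one, by means of slice charts.\<close>

definition smooth_hypersurface :: "'m topology \<Rightarrow> ('m, 'n::finite) chart set \<Rightarrow> 'm set \<Rightarrow> bool" where
  "smooth_hypersurface X A N \<longleftrightarrow> N \<subseteq> topspace X \<and>
     (\<forall>q\<in>N. \<exists>c\<in>A. \<exists>i. q \<in> fst c \<and>
        snd c ` (fst c \<inter> N) = {x \<in> snd c ` fst c. x $ i = 0})"

definition nodal_hypersurface ::
    "'m topology \<Rightarrow> ('m, 'n::finite) chart set \<Rightarrow> ('m \<Rightarrow> real) \<Rightarrow> 'm set \<Rightarrow> bool" where
  "nodal_hypersurface X A f N \<longleftrightarrow>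
     smooth_hypersurface X A N \<and> N \<subseteq> {q \<in> topspace X. f q = 0}"

definition tangent_space_of ::
    "'m topology \<Rightarrow> ('m, 'n::finite) chart set \<Rightarrow> 'm set \<Rightarrow> 'm \<Rightarrow> 'm tvec set" where
  "tangent_space_of X A N p =
     {velocity X A \<gamma> | \<gamma>. smooth_curve_at X A p \<gamma> \<and> (\<forall>\<^sub>F t in nhds 0. \<gamma> t \<in> N)}"

definition unit_normal ::
    "'m topology \<Rightarrow> ('m, 'n::finite) chart set \<Rightarrow> 'm metric \<Rightarrow> 'm set \<Rightarrow> 'm \<Rightarrow> 'm tvec \<Rightarrow> bool" where
  "unit_normal X A g N p \<eta> \<longleftrightarrow>
     \<eta> \<in> tangent_space X A p \<and> g p \<eta> \<eta> = 1 \<and> (\<forall>v\<in>tangent_space_of X A N p. g p \<eta> v = 0)"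

end

(* The lowest-order homogeneous Taylor polynomial P of the eigenfunction at p is harmonic for the inner
   product of T_p M, and it vanishes on the hyperplanes tangent to M1 and M2. Suppose these are distinct;
   let E be the plane spanned by their normals and V its orthogonal complement. Among the points z of V
   take one at which P vanishes to minimal order m <= n0 in the directions of E. Minimality makes the
   derivatives along V drop out of the Laplace equation at that order, so the part of degree m in the
   E-variables is a nonzero harmonic polynomial in the plane, r^m (a cos(m t) + c sin(m t)). It
   vanishes on the two lines of E orthogonal to the normals, hence their angle is a multiple of pi/m. *)
theory Submission
  imports Defs
begin

text \<open>Simply restricting \<open>P\<close> to \<open>E\<close> fails twice. The Laplacian also
  contains second derivatives along \<open>V\<close>, so the restriction need not be harmonic; and
  it may vanish identically, as x y z does for the hyperplanes x = 0 and y = 0, where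
  \<open>E\<close> is the x-y-plane. Moving the base point to some z in \<open>V\<close> cures the
  second defect: at z = 1 the example becomes x y, with m = 2 although n0 = 3. This is why all
  denominators up to n0 can occur. Minimality of m cures the first: a term with two arguments moved
  from \<open>E\<close> to \<open>V\<close> has only m - 2 arguments left in \<open>E\<close>, and
  such terms vanish at every point of \<open>V\<close>. Any chart around p serves in place of normal
  coordinates. When the equation is differentiated n0 - 2 times at p, only its second-order part
  survives, with the metric frozen at p; so harmonicity is expressed by the inverse Gram matrix in
  that chart. The normals span no plane if they are equal or opposite. Then the angle is 0 or pi,
  which lies in the set because n0 is positive.\<close>

section \<open>Symmetric multilinear forms\<close>

text \<open>Multisets as arguments build the symmetry into the type, so linearity in one slot is all
  that has to be assumed. On multisets of size k, \<open>T\<close> is the polarised form of a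
  homogeneous polynomial of degree k. The \<open>M\<close> carried through the lemmas holds the
  arguments kept fixed.\<close>

locale symmetric_multilinear =
  fixes T :: "'a::real_vector multiset \<Rightarrow> real"
  assumes add: "T (add_mset (u + v) M) = T (add_mset u M) + T (add_mset v M)"
    and scale: "T (add_mset (r *\<^sub>R u) M) = r * T (add_mset u M)"
begin

lemma zero: "T (add_mset 0 M) = 0"
  using scale[of 0 0 M] by simp

lemma sum: "T (add_mset (\<Sum>i\<in>I. r i *\<^sub>R u i) M) = (\<Sum>i\<in>I. r i * T (add_mset (u i) M))"
  by (induction I rule: infinite_finite_induct) (simp_all add: zero add scale)

lemma replicate_scale: "T (replicate_mset k (r *\<^sub>R u) + M) = r ^ k * T (replicate_mset k u + M)"
proof (induction k arbitrary: M)
  case (Suc k)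
  have "T (replicate_mset (Suc k) (r *\<^sub>R u) + M) = r ^ k * T (replicate_mset k u + add_mset (r *\<^sub>R u) M)"
    using Suc[of "add_mset (r *\<^sub>R u) M"] by simp
  then show ?case by (simp add: scale)
qed simp

lemma binomial:
  "T (replicate_mset k (u + v) + M) =
    (\<Sum>j\<le>k. real (k choose j) * T (replicate_mset j u + replicate_mset (k - j) v + M))"
proof (induction k arbitrary: M)
  case (Suc k)
  let ?t = "\<lambda>i j. T (replicate_mset i u + replicate_mset j v + M)"
  have "T (replicate_mset (Suc k) (u + v) + M) =
      T (replicate_mset k (u + v) + add_mset u M) + T (replicate_mset k (u + v) + add_mset v M)"
    by (simp add: add)
  also have "\<dots> = (\<Sum>j\<le>k. real (k choose j) * ?t (Suc j) (k - j)) +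
      (\<Sum>j\<le>k. real (k choose j) * ?t j (Suc k - j))"
    unfolding Suc.IH by (simp add: Suc_diff_le)
  also have "(\<Sum>j\<le>k. real (k choose j) * ?t j (Suc k - j)) =
      (\<Sum>j\<le>Suc k. real (k choose j) * ?t j (Suc k - j))"
    by simp
  also have "\<dots> = ?t 0 (Suc k) + (\<Sum>j\<le>k. real (k choose Suc j) * ?t (Suc j) (k - j))"
    by (subst sum.atMost_Suc_shift) simp
  finally have "T (replicate_mset (Suc k) (u + v) + M) =
      ?t 0 (Suc k) + (\<Sum>j\<le>k. real (Suc k choose Suc j) * ?t (Suc j) (k - j))"
    by (simp add: sum.distrib algebra_simps)
  also have "\<dots> = (\<Sum>j\<le>Suc k. real (Suc k choose j) * ?t j (Suc k - j))"
    by (subst sum.atMost_Suc_shift) simp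
  finally show ?case .
qed simp

text \<open>By \<open>binomial\<close> the hypothesis concerns a polynomial in t, so each of its
  coefficients vanishes; the binomial factor is nonzero for j up to k.\<close>

lemma coefficient_zero:
  assumes "\<And>t. T (replicate_mset k (u + t *\<^sub>R v) + M) = 0" and "j \<le> k"
  shows "T (replicate_mset j v + replicate_mset (k - j) u + M) = 0"
proof -
  let ?c = "\<lambda>j. real (k choose j) * T (replicate_mset j v + replicate_mset (k - j) u + M)"
  have "(\<Sum>j\<le>k. ?c j * t ^ j) = 0" for t
    using assms(1)[of t] binomial[of k "t *\<^sub>R v" u M]
    by (simp add: replicate_scale add.commute[of u] add.assoc mult_ac)
  then have "?c j = 0"
    using polyfun_eq_0[of ?c k] assms(2) by blast
  with assms(2) show ?thesis by simp
qed

text \<open>The coefficient of t along h + t v replaces one copy of h by v, so the vectors of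
  \<open>N\<close> can be split off one at a time. Since \<open>V\<close> is a subspace, h + t v
  stays in it.\<close>

lemma polarization:
  assumes "subspace V" and "\<And>h. h \<in> V \<Longrightarrow> T (replicate_mset (size N) h + M) = 0"
    and "set_mset N \<subseteq> V"
  shows "T (N + M) = 0"
  using assms(2,3)
proof (induction N arbitrary: M)
  case empty
  then show ?case using subspace_0[OF assms(1)] by auto
next
  case (add v N)
  have "T (replicate_mset (size N) h + add_mset v M) = 0" if "h \<in> V" for h
  proof -
    have "T (replicate_mset (Suc (size N)) (h + t *\<^sub>R v) + M) = 0" for t
      using add.prems that assms(1) by (auto simp: subspace_add subspace_scale)
    from coefficient_zero[OF this, of 1] show ?thesis by simp
  qed
  from add.IH[OF this] add.prems show ?case by simp
qed

lemma plane_expansion: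
  assumes "\<And>N. size N = k \<Longrightarrow> set_mset N \<subseteq> {d, e} \<Longrightarrow> T (N + M) = 0"
  shows "T (replicate_mset k (x *\<^sub>R d + y *\<^sub>R e) + M) = 0"
  using assms
proof (induction k arbitrary: M)
  case (Suc k)
  let ?w = "x *\<^sub>R d + y *\<^sub>R e"
  have "T (replicate_mset k ?w + add_mset w M) = 0" if "w \<in> {d, e}" for w
  proof (rule Suc.IH)
    fix N assume "size N = k" "set_mset N \<subseteq> {d, e}"
    with Suc.prems[of "add_mset w N"] that show "T (N + add_mset w M) = 0" by simp
  qed
  then have "T (replicate_mset k ?w + add_mset d M) = 0" "T (replicate_mset k ?w + add_mset e M) = 0"
    by auto
  then show ?case by (simp add: add scale)
qed simp

text \<open>In the plane of \<open>d\<close> and \<open>e\<close> the hypothesis says that \<open>w \<mapsto> T (w\<^sup>m M)\<close> is a harmonic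
  homogeneous polynomial, hence of the form \<open>r\<^sup>m (a cos m\<theta> + b sin m\<theta>)\<close>.\<close>

lemma harmonic_plane:
  assumes harm: "\<And>N. size N + 2 = m \<Longrightarrow> set_mset N \<subseteq> {d, e} \<Longrightarrow>
      T ({#d, d#} + N + M) + T ({#e, e#} + N + M) = 0"
    and "Suc k + size N = m" and "set_mset N \<subseteq> {d, e}"
  shows "T (replicate_mset (Suc k) (cos \<theta> *\<^sub>R d + sin \<theta> *\<^sub>R e) + N + M) =
    cos (real (Suc k) * \<theta>) * T (replicate_mset (Suc k) d + N + M) +
    sin (real (Suc k) * \<theta>) * T (add_mset e (replicate_mset k d) + N + M)"
  using assms(2,3)
proof (induction k arbitrary: N)
  case 0
  then show ?case by (simp add: add scale)
next
  case (Suc k)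
  let ?u = "cos \<theta> *\<^sub>R d + sin \<theta> *\<^sub>R e"
  define c s where "c = cos (real (Suc k) * \<theta>)" and "s = sin (real (Suc k) * \<theta>)"
  have split: "T (replicate_mset (Suc (Suc k)) ?u + N + M) =
      cos \<theta> * T (replicate_mset (Suc k) ?u + add_mset d N + M) +
      sin \<theta> * T (replicate_mset (Suc k) ?u + add_mset e N + M)"
    using add[of "cos \<theta> *\<^sub>R d" "sin \<theta> *\<^sub>R e" "replicate_mset (Suc k) ?u + N + M"]
    by (simp add: scale)
  have d: "T (replicate_mset (Suc k) ?u + add_mset d N + M) =
      c * T (replicate_mset (Suc k) d + add_mset d N + M) +
      s * T (add_mset e (replicate_mset k d) + add_mset d N + M)"
    unfolding c_def s_def by (rule Suc.IH) (use Suc.prems in auto)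
  have e: "T (replicate_mset (Suc k) ?u + add_mset e N + M) =
      c * T (replicate_mset (Suc k) d + add_mset e N + M) +
      s * T (add_mset e (replicate_mset k d) + add_mset e N + M)"
    unfolding c_def s_def by (rule Suc.IH) (use Suc.prems in auto)
  have h: "T ({#e, e#} + (replicate_mset k d + N) + M) = - T ({#d, d#} + (replicate_mset k d + N) + M)"
    using harm[of "replicate_mset k d + N"] Suc.prems by (cases "k = 0") (auto simp: eq_neg_iff_add_eq_0 add.commute)
  have "cos (real (Suc (Suc k)) * \<theta>) = c * cos \<theta> - s * sin \<theta>"
    "sin (real (Suc (Suc k)) * \<theta>) = s * cos \<theta> + c * sin \<theta>"
    unfolding c_def s_def cos_add[symmetric] sin_add[symmetric] by (simp_all add: algebra_simps)
  note trig = this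
  show ?case
    unfolding split d e trig using h by (simp add: algebra_simps add_mset_commute[of e d])
qed

text \<open>Trading pairs e, e for d, d up to sign leaves at most one e, so a harmonic form of
  degree m in the plane is determined by the two coefficients that are zero here.\<close>

lemma harmonic_plane_zero:
  assumes harm: "\<And>N. size N + 2 = m \<Longrightarrow> set_mset N \<subseteq> {d, e} \<Longrightarrow>
      T ({#d, d#} + N + M) + T ({#e, e#} + N + M) = 0"
    and "T (replicate_mset m d + M) = 0" and "T (add_mset e (replicate_mset (m - 1) d) + M) = 0"
    and "size N = m" and "set_mset N \<subseteq> {d, e}"
  shows "T (N + M) = 0"
proof -
  have "T (replicate_mset a d + replicate_mset b e + M) = 0" if "a + b = m" for a b
    using that
  proof (induction b arbitrary: a rule: less_induct)
    case (less b)
    consider "b = 0" | "b = 1" | b' where "b = Suc (Suc b')"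
      by (metis One_nat_def not0_implies_Suc)
    then show ?case
    proof cases
      case 3
      let ?N = "replicate_mset a d + replicate_mset b' e"
      have "T ({#d, d#} + ?N + M) + T ({#e, e#} + ?N + M) = 0"
        using less.prems 3 by (intro harm) (auto split: if_splits)
      moreover have "T ({#d, d#} + ?N + M) = 0"
        using less.IH[of b' "Suc (Suc a)"] less.prems 3 by simp
      ultimately show ?thesis using 3 by simp
    qed (use assms(2,3) less.prems in auto)
  qed
  moreover have "\<exists>a b. N = replicate_mset a d + replicate_mset b e"
    using \<open>set_mset N \<subseteq> {d, e}\<close>
  proof (induction N)
    case (add x N)
    then obtain a b where "N = replicate_mset a d + replicate_mset b e" by auto
    then have "add_mset d N = replicate_mset (Suc a) d + replicate_mset b e"
      "add_mset e N = replicate_mset a d + replicate_mset (Suc b) e"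
      by auto
    with add.prems show ?case by (metis insertE insert_subset set_mset_add_mset_insert singletonD)
  qed auto
  ultimately show ?thesis using \<open>size N = m\<close> by force
qed

end

section \<open>Harmonic forms vanishing on two hyperplanes\<close>

text \<open>The matrix \<open>K\<close> is the inverse of the Gram matrix of \<open>b\<close>, so \<open>lap\<close> says that the polynomial
  \<open>h \<mapsto> T (h\<^sup>n)\<close> is harmonic for \<open>b\<close>.\<close>

locale harmonic_form = symmetric_multilinear T for T :: "(real^'n::finite) multiset \<Rightarrow> real" +
  fixes b :: "real^'n \<Rightarrow> real^'n \<Rightarrow> real" and K :: "real^'n^'n" and n :: nat
  assumes bilin: "bilinear b" and sym: "b u v = b v u"
    and K1: "(\<Sum>i\<in>UNIV. K $ i $ j * b (axis i 1) v) = v $ j"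
    and K2: "(\<Sum>j\<in>UNIV. K $ i $ j * b (axis j 1) v) = v $ i"
    and lap: "size N + 2 = n \<Longrightarrow>
      (\<Sum>i\<in>UNIV. \<Sum>j\<in>UNIV. K $ i $ j * T ({#axis i 1, axis j 1#} + N)) = 0"
begin

text \<open>The trace of the form \<open>B\<close> with respect to \<open>b\<close> is its trace on
  the plane of d and e plus its trace on the orthogonal complement, where \<open>orth_zero\<close>
  makes \<open>B\<close> vanish. Instead of completing d, e to an orthonormal basis, the proof
  splits each coordinate vector into its plane part and a remainder \<open>z i\<close>.\<close>

lemma plane_laplacian:
  assumes orth: "b d d = 1" "b e e = 1" "b d e = 0" and "size N + 2 = n"
    and orth_zero: "\<And>y z. b d y = 0 \<Longrightarrow> b e y = 0 \<Longrightarrow> b d z = 0 \<Longrightarrow> b e z = 0 \<Longrightarrow> T ({#y, z#} + N) = 0"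
  shows "T ({#d, d#} + N) + T ({#e, e#} + N) = 0"
proof -
  define B where "B u v = T ({#u, v#} + N)" for u v
  have B_sum1: "(\<Sum>i\<in>UNIV. v $ i * B (axis i 1) w) = B v w" for v w
    using sum[of "\<lambda>i. v $ i" "\<lambda>i. axis i 1" UNIV "add_mset w N"] basis_expansion[of v]
    by (simp add: B_def scalar_mult_eq_scaleR)
  have B_sym: "B u v = B v u" for u v by (simp add: B_def add_mset_commute)
  have B_add: "B (u + v) w = B u w + B v w" "B w (u + v) = B w u + B w v" for u v w
    using add[of u v "add_mset w N"] by (simp_all add: B_def add_mset_commute)
  have B_scale: "B (r *\<^sub>R u) w = r * B u w" "B w (r *\<^sub>R u) = r * B w u" for r u w
    using scale[of r u "add_mset w N"] by (simp_all add: B_def add_mset_commute)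
  define p q z where "p i = b (axis i 1) d" and "q i = b (axis i 1) e"
    and "z i = axis i 1 - p i *\<^sub>R d - q i *\<^sub>R e" for i
  have dec: "axis i 1 = p i *\<^sub>R d + q i *\<^sub>R e + z i" for i by (simp add: z_def)
  have z: "b d (z i) = 0" "b e (z i) = 0" for i
    unfolding z_def p_def q_def using orth sym[of "axis i 1"] sym[of e d]
    by (simp_all add: bilinear_rsub[OF bilin] bilinear_rmul[OF bilin])
  have zz: "B (z i) (z j) = 0" for i j using orth_zero z by (simp add: B_def)
  have Kp: "(\<Sum>i\<in>UNIV. K $ i $ j * p i) = d $ j" "(\<Sum>j\<in>UNIV. K $ i $ j * p j) = d $ i"
    and Kq: "(\<Sum>i\<in>UNIV. K $ i $ j * q i) = e $ j" "(\<Sum>j\<in>UNIV. K $ i $ j * q j) = e $ i" for i j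
    by (simp_all add: p_def q_def K1 K2)
  have "(\<Sum>i\<in>UNIV. v $ i *\<^sub>R z i) = v - b v d *\<^sub>R d - b v e *\<^sub>R e" for v
  proof -
    have "b v w = (\<Sum>i\<in>UNIV. v $ i * b (axis i 1) w)" for w
    proof -
      have "b (\<Sum>i\<in>UNIV. v $ i *\<^sub>R axis i 1) w = (\<Sum>i\<in>UNIV. b (v $ i *\<^sub>R axis i 1) w)"
        using bilin linear_sum unfolding bilinear_def by blast
      then show ?thesis
        using basis_expansion[of v] by (simp add: bilinear_lmul[OF bilin] scalar_mult_eq_scaleR)
    qed
    then show ?thesis
      using basis_expansion[of v]
      by (simp add: z_def p_def q_def algebra_simps sum_subtractf sum.distrib scaleR_sum_left scalar_mult_eq_scaleR)
  qed
  \<comment> \<open>The vectors d and e have no component orthogonal to the plane. Contraction with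
    \<open>K\<close> turns the mixed terms of the trace into exactly these two sums.\<close>
  then have zd: "(\<Sum>i\<in>UNIV. d $ i *\<^sub>R z i) = 0" and ze: "(\<Sum>i\<in>UNIV. e $ i *\<^sub>R z i) = 0"
    using orth sym[of e d] by simp_all
  have B_z: "(\<Sum>j\<in>UNIV. r j * B w (z j)) = B w (\<Sum>j\<in>UNIV. r j *\<^sub>R z j)" for r w
    using sum[of r z UNIV "add_mset w N"] by (simp add: B_def add_mset_commute)
  have B0: "B w 0 = 0" for w using zero[of "add_mset w N"]
    by (simp add: B_def add_mset_commute)
  have dec1: "B (axis i 1) w = p i * B d w + q i * B e w + B (z i) w"
    and dec2: "B w (axis i 1) = p i * B w d + q i * B w e + B w (z i)" for i w
    by (simp_all only: dec[of i] B_add B_scale)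
  have inner: "(\<Sum>j\<in>UNIV. K $ i $ j * B (axis i 1) (axis j 1)) =
      d $ i * B (axis i 1) d + e $ i * B (axis i 1) e + (\<Sum>j\<in>UNIV. K $ i $ j * B (axis i 1) (z j))" for i
  proof -
    have "(\<Sum>j\<in>UNIV. K $ i $ j * B (axis i 1) (axis j 1)) =
      (\<Sum>j\<in>UNIV. K $ i $ j * p j) * B (axis i 1) d + (\<Sum>j\<in>UNIV. K $ i $ j * q j) * B (axis i 1) e
        + (\<Sum>j\<in>UNIV. K $ i $ j * B (axis i 1) (z j))"
      unfolding dec2[of "axis _ 1"]
      by (simp add: sum_distrib_left sum_distrib_right sum.distrib algebra_simps)
    then show ?thesis by (simp add: Kp Kq)
  qed
  have outer: "(\<Sum>i\<in>UNIV. K $ i $ j * B (axis i 1) (z j)) = d $ j * B d (z j) + e $ j * B e (z j)" for j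
  proof -
    have "(\<Sum>i\<in>UNIV. K $ i $ j * B (axis i 1) (z j)) =
      (\<Sum>i\<in>UNIV. K $ i $ j * p i) * B d (z j) + (\<Sum>i\<in>UNIV. K $ i $ j * q i) * B e (z j)"
      unfolding dec1
      by (simp add: zz sum_distrib_left sum_distrib_right sum.distrib algebra_simps)
    then show ?thesis by (simp add: Kp Kq)
  qed
  have "0 = (\<Sum>i\<in>UNIV. \<Sum>j\<in>UNIV. K $ i $ j * B (axis i 1) (axis j 1))"
    using lap[OF \<open>size N + 2 = n\<close>] by (simp add: B_def)
  also have "\<dots> = B d d + B e e + (\<Sum>i\<in>UNIV. \<Sum>j\<in>UNIV. K $ i $ j * B (axis i 1) (z j))"
    by (simp add: inner sum.distrib B_sum1)
  also have "(\<Sum>i\<in>UNIV. \<Sum>j\<in>UNIV. K $ i $ j * B (axis i 1) (z j)) =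
      (\<Sum>j\<in>UNIV. d $ j * B d (z j) + e $ j * B e (z j))"
    by (subst sum.swap) (simp add: outer)
  also have "\<dots> = 0" by (simp add: sum.distrib B_z zd ze B0)
  finally show ?thesis by (simp add: B_def)
qed

theorem angle:
  assumes unit: "b \<eta> \<eta> = 1" "b \<xi> \<xi> = 1" and lt: "\<bar>b \<eta> \<xi>\<bar> < 1"
    and nz: "T (replicate_mset n h0) \<noteq> 0"
    and van1: "\<And>h. b \<eta> h = 0 \<Longrightarrow> T (replicate_mset n h) = 0"
    and van2: "\<And>h. b \<xi> h = 0 \<Longrightarrow> T (replicate_mset n h) = 0"
  shows "\<exists>m\<in>{1..n}. \<exists>a\<in>{0..m}. arccos (b \<eta> \<xi>) = real a / real m * pi"
proof -
  define \<alpha> where "\<alpha> = arccos (b \<eta> \<xi>)"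
  have \<alpha>: "0 < \<alpha>" "\<alpha> < pi" "cos \<alpha> = b \<eta> \<xi>"
    using lt arccos_lt_bounded[of "b \<eta> \<xi>"] by (auto simp: \<alpha>_def abs_if split: if_splits)
  have s: "sin \<alpha> > 0" using \<alpha> by (simp add: sin_gt_zero)
  note b_simps = bilinear_rsub[OF bilin] bilinear_rmul[OF bilin] bilinear_lsub[OF bilin]
    bilinear_lmul[OF bilin] bilinear_radd[OF bilin] bilinear_ladd[OF bilin]
  \<comment> \<open>Gram-Schmidt: d completes \<eta> to an orthonormal basis of the plane, with
    \<xi> at angle \<alpha> from \<eta>.\<close>
  define d where "d = (1 / sin \<alpha>) *\<^sub>R (\<xi> - cos \<alpha> *\<^sub>R \<eta>)"
  have \<xi>: "\<xi> = sin \<alpha> *\<^sub>R d + cos \<alpha> *\<^sub>R \<eta>" using s by (simp add: d_def)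
  have \<eta>d: "b \<eta> d = 0" using unit \<alpha> by (simp add: d_def b_simps)
  then have d\<eta>: "b d \<eta> = 0" using sym by metis
  have "b \<xi> \<xi> = (sin \<alpha>)\<^sup>2 * b d d + (cos \<alpha>)\<^sup>2"
    by (subst (1 2) \<xi>) (simp add: b_simps \<eta>d d\<eta> unit power2_eq_square)
  then have "(sin \<alpha>)\<^sup>2 * b d d = (sin \<alpha>)\<^sup>2" using unit sin_cos_squared_add[of \<alpha>] by linarith
  then have dd: "b d d = 1" using s by simp
  define V where "V = {z. b d z = 0 \<and> b \<eta> z = 0}"
  have V: "subspace V"
    by (auto simp: V_def subspace_def b_simps bilinear_rzero[OF bilin])
  \<comment> \<open>For h = w + z with w in the plane and z in \<open>V\<close>, the part of the
    polynomial of degree m in w is, up to a binomial factor, \<open>T\<close> at m copies of w and n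
    - m copies of z. \<open>P m\<close> says that this part is not identically zero, tested on
    products of the basis vectors d and \<eta>.\<close>
  define P where "P m \<longleftrightarrow> (\<exists>z N. z \<in> V \<and> set_mset N \<subseteq> {d, \<eta>} \<and> size N = m \<and> m \<le> n \<and>
    T (N + replicate_mset (n - m) z) \<noteq> 0)" for m
  have "\<exists>m. P m"
  proof (rule ccontr)
    assume no: "\<nexists>m. P m"
    define w z where "w = b d h0 *\<^sub>R d + b \<eta> h0 *\<^sub>R \<eta>" and "z = h0 - w"
    have "z \<in> V" using dd d\<eta> \<eta>d unit by (simp add: V_def z_def w_def b_simps)
    with no have "T (N + replicate_mset (n - m) z) = 0"
      if "set_mset N \<subseteq> {d, \<eta>}" "size N = m" "m \<le> n" for N m
      using that unfolding P_def by blast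
    then have "T (replicate_mset j w + replicate_mset (n - j) z) = 0" if "j \<le> n" for j
      unfolding w_def using that by (intro plane_expansion) auto
    then have "T (replicate_mset n (w + z) + {#}) = 0"
      by (subst binomial) (simp add: sum.neutral)
    then show False using nz by (simp add: z_def)
  qed
  define m where "m = (LEAST m. P m)"
  have "P m" unfolding m_def using \<open>\<exists>m. P m\<close> by (rule LeastI_ex)
  then obtain z N0 where z: "z \<in> V" and N0: "set_mset N0 \<subseteq> {d, \<eta>}" "size N0 = m" and "m \<le> n"
    and N0_nz: "T (N0 + replicate_mset (n - m) z) \<noteq> 0"
    unfolding P_def by blast
  have below: "T (N + replicate_mset (n - j) y) = 0"
    if "set_mset N \<subseteq> {d, \<eta>}" "size N = j" "j < m" "y \<in> V" for N j y
  proof -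
    have "\<not> P j" using not_less_Least[of j P] that(3) unfolding m_def .
    moreover have "j \<le> n" using that(3) \<open>m \<le> n\<close> by simp
    ultimately show ?thesis using that unfolding P_def by blast
  qed
  let ?M = "replicate_mset (n - m) z"
  have harm: "T ({#d, d#} + N + ?M) + T ({#\<eta>, \<eta>#} + N + ?M) = 0"
    if N: "size N + 2 = m" "set_mset N \<subseteq> {d, \<eta>}" for N
  proof -
    have "T ({#d, d#} + (N + ?M)) + T ({#\<eta>, \<eta>#} + (N + ?M)) = 0"
    proof (rule plane_laplacian)
      show "size (N + ?M) + 2 = n" using N \<open>m \<le> n\<close> by simp
      \<comment> \<open>Here only m - 2 arguments come from the plane, so minimality of m gives zero
        whenever the remaining ones are equal vectors of \<open>V\<close>; polarization admits the
        different vectors y, y' and z.\<close>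
      fix y y' assume "b d y = 0" "b \<eta> y = 0" "b d y' = 0" "b \<eta> y' = 0"
      then have "set_mset ({#y, y'#} + ?M) \<subseteq> V" using z by (auto simp: V_def split: if_splits)
      moreover have "T (replicate_mset (size ({#y, y'#} + ?M)) h + N) = 0" if "h \<in> V" for h
      proof -
        have "size ({#y, y'#} + ?M) = n - size N" using N \<open>m \<le> n\<close> by simp
        then show ?thesis using below[of N "size N" h] N that by (simp add: add.commute)
      qed
      ultimately have "T ({#y, y'#} + ?M + N) = 0" using polarization[OF V] by blast
      then show "T ({#y, y'#} + (N + ?M)) = 0" by (simp add: ac_simps)
    qed (use dd unit d\<eta> in auto)
    then show ?thesis by (simp add: ac_simps)
  qed
  have "m \<noteq> 0"
  proof
    assume "m = 0"
    then have "T (replicate_mset n z) \<noteq> 0" using N0 N0_nz by simp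
    with van1 z show False by (simp add: V_def)
  qed
  then obtain k where m: "m = Suc k" using not0_implies_Suc by blast
  define a where "a = T (replicate_mset m d + ?M)"
  define c where "c = T (add_mset \<eta> (replicate_mset k d) + ?M)"
  have line: "T (replicate_mset m u + ?M) = 0"
    if "\<And>t. T (replicate_mset n (z + t *\<^sub>R u)) = 0" for u
    using coefficient_zero[of n z u "{#}" m] that \<open>m \<le> n\<close> by simp
  \<comment> \<open>Since d is orthogonal to \<eta>, the line z + t d stays in the first hyperplane.
    This removes the cosine part.\<close>
  have a: "a = 0"
    unfolding a_def
    by (rule line, rule van1) (use z \<eta>d in \<open>simp add: V_def b_simps\<close>)
  have c: "c \<noteq> 0"
    using harmonic_plane_zero[of m d \<eta> ?M N0] harm a N0 N0_nz by (auto simp: a_def c_def m)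
  \<comment> \<open>The direction in the plane orthogonal to \<xi>: the second line lies at angle
    -\<alpha> from d.\<close>
  let ?u = "cos (- \<alpha>) *\<^sub>R d + sin (- \<alpha>) *\<^sub>R \<eta>"
  have "T (replicate_mset m ?u + ?M) = 0"
  proof (rule line, rule van2)
    show "b \<xi> (z + t *\<^sub>R ?u) = 0" for t
      using z dd d\<eta> \<eta>d unit by (subst \<xi>) (simp add: V_def b_simps)
  qed
  moreover have "T (replicate_mset m ?u + ?M) = cos (real m * (- \<alpha>)) * a + sin (real m * (- \<alpha>)) * c"
    using harmonic_plane[of m d \<eta> ?M k "{#}" "- \<alpha>"] harm unfolding a_def c_def m by simp
  ultimately have "sin (real m * \<alpha>) = 0" using a c by simp
  then obtain i :: int where i: "real m * \<alpha> = real_of_int i * pi"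
    using sin_zero_iff_int2 by blast
  have "real_of_int i * pi \<ge> 0" "real_of_int i * pi \<le> real m * pi"
    using \<alpha> by (simp_all flip: i add: mult_left_mono)
  then have "i \<ge> 0" "i \<le> int m"
    using pi_gt_zero by (simp_all add: zero_le_mult_iff)
  then have "nat i \<in> {0..m}" "real (nat i) = of_int i" by auto
  moreover have "\<alpha> = of_int i / real m * pi" using i \<open>m \<noteq> 0\<close> by (simp add: field_simps)
  moreover have "m \<in> {1..n}" using \<open>m \<noteq> 0\<close> \<open>m \<le> n\<close> by simp
  ultimately show ?thesis unfolding \<alpha>_def[symmetric] by metis
qed

end

section \<open>Functions of class \<open>C\<^sup>k\<close>\<close>

lemma frechet_derivative_eqI:
  "(f has_derivative f') (at x) \<Longrightarrow> frechet_derivative f (at x) = f'"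
  using frechet_derivative_at by metis

text \<open>On an open set derivatives depend only on the values in the set, so identities valid
  merely on \<open>S\<close> may be substituted before differentiating further.\<close>

lemma Ck_on_cong:
  assumes "open S" and "\<And>x. x \<in> S \<Longrightarrow> f x = g x" and "Ck_on k S f"
  shows "Ck_on k S g"
  using assms(2,3)
proof (induction k arbitrary: f g)
  case 0
  then show ?case by (simp cong: continuous_on_cong)
next
  case (Suc k)
  have eq: "frechet_derivative f (at x) = frechet_derivative g (at x)" if "x \<in> S" for x
    using Suc.prems that assms(1)
    by (intro frechet_derivative_transform_within_open[of f x S g]) auto
  have "g differentiable (at x)" if "x \<in> S" for x
    using Suc.prems that assms(1) unfolding differentiable_def Ck_on.simps
    by (meson has_derivative_transform_within_open)
  moreover have "Ck_on k S (\<lambda>x. frechet_derivative g (at x) v)" for v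
    by (rule Suc.IH[of "\<lambda>x. frechet_derivative f (at x) v"]) (use eq Suc.prems in auto)
  ultimately show ?case by simp
qed

lemma Ck_on_SucI:
  assumes "open S" and "\<And>x. x \<in> S \<Longrightarrow> (f has_derivative f' x) (at x)"
    and "\<And>v. Ck_on k S (\<lambda>x. f' x v)"
  shows "Ck_on (Suc k) S f"
proof -
  have "Ck_on k S (\<lambda>x. frechet_derivative f (at x) v)" for v
    by (rule Ck_on_cong[OF assms(1) _ assms(3)[of v]])
      (use assms(2) frechet_derivative_eqI in metis)
  then show ?thesis using assms(2) by (auto simp: differentiable_def)
qed

lemma Ck_on_SucD:
  assumes "Ck_on (Suc k) S f"
  shows "x \<in> S \<Longrightarrow> (f has_derivative frechet_derivative f (at x)) (at x)"
    and "Ck_on k S (\<lambda>x. frechet_derivative f (at x) v)"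
  using assms frechet_derivative_works by auto

lemma Ck_on_subset: "Ck_on k S f \<Longrightarrow> T \<subseteq> S \<Longrightarrow> Ck_on k T f"
  by (induction k arbitrary: f) (auto intro: continuous_on_subset)

lemma Ck_on_lower: "Ck_on (Suc k) S f \<Longrightarrow> Ck_on k S f"
proof (induction k arbitrary: f)
  case 0
  then show ?case
    by (auto intro!: differentiable_imp_continuous_on simp: differentiable_on_def differentiable_at_withinI)
qed auto

lemma Ck_on_const: "Ck_on k S (\<lambda>x. c)"
  by (induction k arbitrary: c) auto

lemma Ck_on_add:
  assumes "open S" "Ck_on k S f" "Ck_on k S g"
  shows "Ck_on k S (\<lambda>x. f x + g x)"
  using assms(2,3)
proof (induction k arbitrary: f g)
  case (Suc k)
  show ?case
    by (rule Ck_on_SucI[OF assms(1) has_derivative_add[OF Suc.prems[THEN Ck_on_SucD(1)]]])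
      (use Suc in auto)
qed (auto intro: continuous_on_add)

lemma Ck_on_bounded_linear:
  assumes "open S" "bounded_linear L" "Ck_on k S f"
  shows "Ck_on k S (\<lambda>x. L (f x))"
  using assms(3)
proof (induction k arbitrary: f)
  case 0
  then show ?case using bounded_linear.continuous_on[OF assms(2)] by auto
next
  case (Suc k)
  show ?case
    by (rule Ck_on_SucI[OF assms(1)
          bounded_linear.has_derivative[OF assms(2) Suc.prems[THEN Ck_on_SucD(1)]]])
      (use Suc in auto)
qed

lemma Ck_on_mult:
  fixes f g :: "'a::real_normed_vector \<Rightarrow> real"
  assumes "open S" "Ck_on k S f" "Ck_on k S g"
  shows "Ck_on k S (\<lambda>x. f x * g x)"
  using assms(2,3)
proof (induction k arbitrary: f g)
  case (Suc k)
  show ?case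
    by (rule Ck_on_SucI[OF assms(1) has_derivative_mult[OF Suc.prems[THEN Ck_on_SucD(1)]]],
        assumption, assumption)
      (intro Ck_on_add[OF assms(1)] Suc.IH Ck_on_lower[OF Suc.prems(1)] Ck_on_lower[OF Suc.prems(2)]
        Ck_on_SucD(2)[OF Suc.prems(1)] Ck_on_SucD(2)[OF Suc.prems(2)])
qed (auto intro: continuous_on_mult)

lemma Ck_on_sum:
  assumes "open S" "\<And>i. i \<in> I \<Longrightarrow> Ck_on k S (f i)"
  shows "Ck_on k S (\<lambda>x. \<Sum>i\<in>I. f i x)"
  using assms(2)
  by (induction I rule: infinite_finite_induct) (auto intro: Ck_on_const Ck_on_add[OF assms(1)])

lemma Ck_on_prod:
  fixes f :: "'i \<Rightarrow> 'a::real_normed_vector \<Rightarrow> real"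
  assumes "open S" "\<And>i. i \<in> I \<Longrightarrow> Ck_on k S (f i)"
  shows "Ck_on k S (\<lambda>x. \<Prod>i\<in>I. f i x)"
  using assms(2)
  by (induction I rule: infinite_finite_induct) (auto intro: Ck_on_const Ck_on_mult[OF assms(1)])

text \<open>The derivative of 1/f contains 1/f itself, but only one class lower is asked of it, so
  the induction feeds on its own hypothesis.\<close>

lemma Ck_on_inverse:
  fixes f :: "'a::real_normed_vector \<Rightarrow> real"
  assumes "open S" "Ck_on k S f" "\<And>x. x \<in> S \<Longrightarrow> f x \<noteq> 0"
  shows "Ck_on k S (\<lambda>x. inverse (f x))"
  using assms(2)
proof (induction k)
  case 0
  then show ?case using assms(3) by (auto intro: continuous_on_inverse)
next
  case (Suc k)
  have der: "((\<lambda>x. inverse (f x)) has_derivative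
      (\<lambda>v. - 1 * (inverse (f x) * frechet_derivative f (at x) v * inverse (f x)))) (at x)"
    if "x \<in> S" for x
    using Deriv.has_derivative_inverse[OF assms(3)[OF that] Ck_on_SucD(1)[OF Suc.prems that]] by simp
  have "Ck_on k S (\<lambda>x. - 1 * (inverse (f x) * frechet_derivative f (at x) v * inverse (f x)))" for v
    by (intro Ck_on_mult[OF assms(1)] Ck_on_const Suc.IH Ck_on_lower[OF Suc.prems]
        Ck_on_SucD(2)[OF Suc.prems])
  with der show ?case by (intro Ck_on_SucI[OF assms(1)])
qed

text \<open>The same bootstrapping: the derivative is a product of 1/(2 sqrt f) and the derivative
  of f.\<close>

lemma Ck_on_sqrt:
  fixes f :: "'a::real_normed_vector \<Rightarrow> real"
  assumes "open S" "Ck_on k S f" "\<And>x. x \<in> S \<Longrightarrow> f x > 0"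
  shows "Ck_on k S (\<lambda>x. sqrt (f x))"
  using assms(2)
proof (induction k)
  case 0
  then show ?case by (auto intro: continuous_on_real_sqrt)
next
  case (Suc k)
  have der: "((\<lambda>x. sqrt (f x)) has_derivative
      (\<lambda>v. inverse (2 * sqrt (f x)) * frechet_derivative f (at x) v)) (at x)" if "x \<in> S" for x
    using has_derivative_real_sqrt[OF assms(3)[OF that] Ck_on_SucD(1)[OF Suc.prems that]]
    by (rule has_derivative_eq_rhs) (simp add: fun_eq_iff field_simps)
  have "Ck_on k S (\<lambda>x. inverse (2 * sqrt (f x)) * frechet_derivative f (at x) v)" for v
    by (intro Ck_on_mult[OF assms(1)] Ck_on_inverse[OF assms(1)] Ck_on_const Suc.IH
        Ck_on_lower[OF Suc.prems] Ck_on_SucD(2)[OF Suc.prems])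
      (use assms(3) in force)
  with der show ?case by (intro Ck_on_SucI[OF assms(1)])
qed

lemma open_line:
  fixes x v :: "'a::real_normed_vector"
  assumes "open S"
  shows "open {t::real. x + t *\<^sub>R v \<in> S}"
proof -
  note assms
  moreover have "continuous_on UNIV (\<lambda>t::real. x + t *\<^sub>R v)" by (intro continuous_intros)
  ultimately have "open ((\<lambda>t. x + t *\<^sub>R v) -` S)" by (rule open_vimage)
  then show ?thesis by (simp add: vimage_def)
qed

lemma Ck_on_line:
  fixes x v :: "'a::real_normed_vector"
  assumes "open S" "Ck_on k S f"
  shows "Ck_on k {t. x + t *\<^sub>R v \<in> S} (\<lambda>t. f (x + t *\<^sub>R v))"
  using assms(2)
proof (induction k arbitrary: f)
  case 0
  then show ?case
    by (auto intro!: continuous_on_compose2[of S f] continuous_intros)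
next
  case (Suc k)
  have "((\<lambda>t. f (x + t *\<^sub>R v)) has_derivative
      (\<lambda>r. frechet_derivative f (at (x + t *\<^sub>R v)) (r *\<^sub>R v))) (at t)"
    if "t \<in> {t. x + t *\<^sub>R v \<in> S}" for t
    using that
    by (intro has_derivative_compose[of "\<lambda>t. x + t *\<^sub>R v" _ t _ f] Ck_on_SucD(1)[OF Suc.prems])
      (auto intro!: derivative_eq_intros)
  then show ?case
    using Suc.IH[OF Ck_on_SucD(2)[OF Suc.prems]] by (rule Ck_on_SucI[OF open_line[OF assms(1)]])
qed

section \<open>Determinants and inverses of matrix-valued functions\<close>

lemma Ck_on_det:
  fixes M :: "'a::real_normed_vector \<Rightarrow> real^'n^'n"
  assumes "open S" "\<And>i j. Ck_on k S (\<lambda>x. M x $ i $ j)"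
  shows "Ck_on k S (\<lambda>x. det (M x))"
  unfolding det_def
  by (rule Ck_on_sum[OF assms(1)], rule Ck_on_mult[OF assms(1) Ck_on_const],
      rule Ck_on_prod[OF assms(1)], rule assms(2))

lemma matrix_inv_mult:
  fixes M :: "real^'n^'n"
  assumes "det M \<noteq> 0"
  shows "M ** matrix_inv M = mat 1" "matrix_inv M ** M = mat 1"
proof -
  have "\<exists>N. M ** N = mat 1 \<and> N ** M = mat 1"
    using assms invertible_det_nz[of M] unfolding invertible_def by simp
  from someI_ex[OF this] show "M ** matrix_inv M = mat 1" "matrix_inv M ** M = mat 1"
    by (simp_all add: matrix_inv_def)
qed

text \<open>Cramer's rule writes an entry of the inverse as a quotient of two determinants;
  \<open>?R\<close> has column i replaced by the j-th unit vector.\<close>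

lemma Ck_on_matrix_inv:
  fixes M :: "'a::real_normed_vector \<Rightarrow> real^'n^'n"
  assumes "open S" "\<And>i j. Ck_on k S (\<lambda>x. M x $ i $ j)" and "\<And>x. x \<in> S \<Longrightarrow> det (M x) \<noteq> 0"
  shows "Ck_on k S (\<lambda>x. matrix_inv (M x) $ i $ j)"
proof -
  let ?R = "\<lambda>x. \<chi> r c. if c = i then axis j 1 $ r else M x $ r $ c"
  have "det (?R x) * inverse (det (M x)) = matrix_inv (M x) $ i $ j" if "x \<in> S" for x
  proof -
    define y where "y = matrix_inv (M x) *v axis j 1"
    have "M x *v y = axis j 1"
      unfolding y_def matrix_vector_mul_assoc matrix_inv_mult(1)[OF assms(3)[OF that]] by simp
    then have y: "y = (\<chi> k. det (\<chi> r c. if c = k then axis j 1 $ r else M x $ r $ c) / det (M x))"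
      by (rule iffD1[OF cramer[OF assms(3)[OF that]]])
    have "y $ i = det (?R x) / det (M x)" by (subst y) (rule vec_lambda_beta)
    moreover have "y $ i = matrix_inv (M x) $ i $ j"
      unfolding y_def matrix_vector_mult_basis column_def by simp
    ultimately show ?thesis by (simp only: divide_inverse)
  qed
  note eq = this
  have "Ck_on k S (\<lambda>x. ?R x $ r $ c)" for r c
    by (cases "c = i") (simp_all only: vec_lambda_beta refl if_True if_False Ck_on_const assms(2))
  then have "Ck_on k S (\<lambda>x. det (?R x) * inverse (det (M x)))"
    by (rule Ck_on_mult[OF assms(1) Ck_on_det[OF assms(1)]
          Ck_on_inverse[OF assms(1) Ck_on_det[OF assms(1,2)] assms(3)]])
  from Ck_on_cong[OF assms(1) eq this] show ?thesis .
qed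

section \<open>Iterated directional derivatives\<close>

lemma smooth_on_deriv: "smooth_on S f \<Longrightarrow> smooth_on S (\<lambda>x. frechet_derivative f (at x) v)"
  unfolding smooth_on_def by (metis Ck_on_SucD(2))

lemma smooth_on_has_derivative:
  "smooth_on S f \<Longrightarrow> x \<in> S \<Longrightarrow> (f has_derivative frechet_derivative f (at x)) (at x)"
  unfolding smooth_on_def by (meson Ck_on_SucD(1))

lemma smooth_on_continuous: "smooth_on S f \<Longrightarrow> continuous_on S f"
  unfolding smooth_on_def by (metis Ck_on.simps(1))

lemma smooth_on_linear: "smooth_on S f \<Longrightarrow> x \<in> S \<Longrightarrow> linear (frechet_derivative f (at x))"
  using smooth_on_has_derivative has_derivative_linear by blast

text \<open>Fixing the directions keeps derivatives of all orders real-valued, so spaces of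
  multilinear maps are avoided.\<close>

primrec iter_deriv :: "'a::real_normed_vector list \<Rightarrow> ('a \<Rightarrow> real) \<Rightarrow> 'a \<Rightarrow> real" where
  "iter_deriv [] f = f"
| "iter_deriv (v # vs) f = (\<lambda>x. frechet_derivative (iter_deriv vs f) (at x) v)"

lemma iter_deriv_append: "iter_deriv (vs @ ws) f = iter_deriv vs (iter_deriv ws f)"
  by (induction vs) auto

lemma smooth_on_iter_deriv: "smooth_on S f \<Longrightarrow> smooth_on S (iter_deriv vs f)"
  by (induction vs) (auto intro: smooth_on_deriv)

lemma iter_deriv_cong:
  assumes "open S" "\<And>x. x \<in> S \<Longrightarrow> f x = g x" "smooth_on S f" "x \<in> S"
  shows "iter_deriv vs f x = iter_deriv vs g x"
  using assms(4)
proof (induction vs arbitrary: x)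
  case (Cons v vs)
  have "iter_deriv vs f differentiable (at x)"
    using smooth_on_has_derivative[OF smooth_on_iter_deriv[OF assms(3)] Cons.prems]
    by (auto simp: differentiable_def)
  then show ?case
    using frechet_derivative_transform_within_open[OF _ assms(1) Cons.prems Cons.IH] by simp
qed (use assms in auto)

lemma iter_deriv_add:
  assumes "open S" "smooth_on S f" "smooth_on S g" "x \<in> S"
  shows "iter_deriv vs (\<lambda>x. f x + g x) x = iter_deriv vs f x + iter_deriv vs g x"
  using assms(4)
proof (induction vs arbitrary: x)
  case (Cons v vs)
  let ?f = "iter_deriv vs f" and ?g = "iter_deriv vs g"
  note der = has_derivative_add[OF
      smooth_on_has_derivative[OF smooth_on_iter_deriv[OF assms(2)] Cons.prems]
      smooth_on_has_derivative[OF smooth_on_iter_deriv[OF assms(3)] Cons.prems], of vs vs]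
  have "(iter_deriv vs (\<lambda>x. f x + g x) has_derivative
      (\<lambda>v. frechet_derivative ?f (at x) v + frechet_derivative ?g (at x) v)) (at x)"
    by (rule has_derivative_transform_within_open[OF der assms(1) Cons.prems]) (simp add: Cons.IH)
  then show ?case by (simp add: frechet_derivative_eqI)
qed simp

lemma iter_deriv_zero: "iter_deriv vs (\<lambda>x. 0) = (\<lambda>x. 0)"
  by (induction vs) auto

lemma smooth_on_mult: "open S \<Longrightarrow> smooth_on S a \<Longrightarrow> smooth_on S b \<Longrightarrow> smooth_on S (\<lambda>x. a x * b x :: real)"
  and smooth_on_sum: "open S \<Longrightarrow> (\<And>i. i \<in> I \<Longrightarrow> smooth_on S (h i)) \<Longrightarrow> smooth_on S (\<lambda>x. \<Sum>i\<in>I. h i x)"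
  unfolding smooth_on_def by (auto intro: Ck_on_mult Ck_on_sum)

lemma smooth_on_const: "smooth_on S (\<lambda>x. c)"
  unfolding smooth_on_def by (auto intro: Ck_on_const)

lemma smooth_on_subset: "smooth_on S f \<Longrightarrow> T \<subseteq> S \<Longrightarrow> smooth_on T f"
  unfolding smooth_on_def by (auto intro: Ck_on_subset)

lemma iter_deriv_sum:
  assumes "open S" "\<And>i. i \<in> I \<Longrightarrow> smooth_on S (f i)" "x \<in> S"
  shows "iter_deriv vs (\<lambda>x. \<Sum>i\<in>I. f i x) x = (\<Sum>i\<in>I. iter_deriv vs (f i) x)"
  using assms(2)
proof (induction I rule: infinite_finite_induct)
  case (insert i I)
  then show ?case
    using iter_deriv_add[OF assms(1) _ smooth_on_sum[OF assms(1)] assms(3), of "f i" I f]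
    by simp
qed (simp_all add: iter_deriv_zero)

text \<open>By the Leibniz rule, a factor multiplying a function that vanishes to order \<open>k\<close> acts as a
  constant on derivatives of order \<open>k\<close>.\<close>

lemma iter_deriv_mult_vanishing:
  fixes a f :: "'a::real_normed_vector \<Rightarrow> real"
  assumes "open S" "x \<in> S"
  shows "smooth_on S a \<Longrightarrow> smooth_on S f \<Longrightarrow> (\<And>ws. length ws < k \<Longrightarrow> iter_deriv ws f x = 0) \<Longrightarrow>
    length vs \<le> k \<Longrightarrow> iter_deriv vs (\<lambda>x. a x * f x) x = a x * iter_deriv vs f x"
proof (induction vs arbitrary: a f k rule: rev_induct)
  case (snoc v vs)
  let ?D = "\<lambda>f x. frechet_derivative f (at x) v"
  have der: "((\<lambda>x. a x * f x) has_derivative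
      (\<lambda>v. a x * frechet_derivative f (at x) v + frechet_derivative a (at x) v * f x)) (at x)"
    if "x \<in> S" for x
    using snoc.prems that by (intro has_derivative_mult smooth_on_has_derivative)
  have "iter_deriv (vs @ [v]) (\<lambda>x. a x * f x) x = iter_deriv vs (?D (\<lambda>x. a x * f x)) x"
    by (simp add: iter_deriv_append)
  also have "\<dots> = iter_deriv vs (\<lambda>x. a x * ?D f x + ?D a x * f x) x"
    by (rule iter_deriv_cong[OF assms(1) _ _ assms(2)])
      (use snoc.prems frechet_derivative_eqI[OF der] assms(1) in
        \<open>auto intro: smooth_on_deriv smooth_on_mult\<close>)
  also have "\<dots> = iter_deriv vs (\<lambda>x. a x * ?D f x) x + iter_deriv vs (\<lambda>x. ?D a x * f x) x"
    using snoc.prems assms by (intro iter_deriv_add[of S] smooth_on_mult smooth_on_deriv)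
  \<comment> \<open>One differentiation lowers the order of vanishing by one, and the list is one
    shorter too.\<close>
  also have "iter_deriv vs (\<lambda>x. a x * ?D f x) x = a x * iter_deriv vs (?D f) x"
  proof (rule snoc.IH)
    show "iter_deriv ws (?D f) x = 0" if "length ws < k - 1" for ws
      using snoc.prems(3)[of "ws @ [v]"] that by (simp add: iter_deriv_append)
  qed (use snoc.prems in \<open>auto intro: smooth_on_deriv\<close>)
  also have "iter_deriv vs (\<lambda>x. ?D a x * f x) x = ?D a x * iter_deriv vs f x"
    by (rule snoc.IH[where k = k]) (use snoc.prems in \<open>auto intro: smooth_on_deriv\<close>)
  \<comment> \<open>Now \<open>vs\<close> has length strictly below k, so the term in which
    \<open>a\<close> was differentiated drops out.\<close>
  also have "iter_deriv vs f x = 0" using snoc.prems by simp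
  finally show ?case by (simp add: iter_deriv_append)
qed simp

section \<open>Symmetry of iterated derivatives\<close>

text \<open>Both iterated derivatives are limits of the second difference quotient of \<open>f\<close>.\<close>

lemma second_difference:
  fixes f :: "'a::real_normed_vector \<Rightarrow> real"
  assumes S: "smooth_on S f" and "h > 0"
    and box: "\<And>s t. 0 \<le> s \<Longrightarrow> s \<le> h \<Longrightarrow> 0 \<le> t \<Longrightarrow> t \<le> h \<Longrightarrow> x + s *\<^sub>R v + t *\<^sub>R w \<in> S"
  shows "\<exists>s t. 0 \<le> s \<and> s \<le> h \<and> 0 \<le> t \<and> t \<le> h \<and>
    f (x + h *\<^sub>R v + h *\<^sub>R w) - f (x + h *\<^sub>R v) - f (x + h *\<^sub>R w) + f x =
      h\<^sup>2 * iter_deriv [w, v] f (x + s *\<^sub>R v + t *\<^sub>R w)"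
proof -
  let ?Dv = "\<lambda>x. frechet_derivative f (at x) v"
  have line: "((\<lambda>s. g (y + s *\<^sub>R u)) has_real_derivative frechet_derivative g (at (y + s *\<^sub>R u)) u) (at s)"
    if "smooth_on S g" "y + s *\<^sub>R u \<in> S" for g y u s
  proof -
    have "((\<lambda>s. g (y + s *\<^sub>R u)) has_derivative
        (\<lambda>r. frechet_derivative g (at (y + s *\<^sub>R u)) (r *\<^sub>R u))) (at s)"
      by (intro has_derivative_compose[of "\<lambda>s. y + s *\<^sub>R u" _ s _ g] smooth_on_has_derivative[of S] that)
        (auto intro!: derivative_eq_intros)
    then show ?thesis
      unfolding has_field_derivative_def
      by (rule has_derivative_eq_rhs)
        (simp add: fun_eq_iff linear_scale[OF smooth_on_linear[OF that]])
  qed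
  \<comment> \<open>The mean value theorem is applied along v to the difference in direction w, then
    along w to the derivative in direction v.\<close>
  let ?p = "\<lambda>s. f (x + h *\<^sub>R w + s *\<^sub>R v) - f (x + s *\<^sub>R v)"
  have "\<exists>s. 0 < s \<and> s < h \<and> ?p h - ?p 0 = (h - 0) * (?Dv (x + h *\<^sub>R w + s *\<^sub>R v) - ?Dv (x + s *\<^sub>R v))"
  proof (rule MVT2[OF \<open>h > 0\<close>])
    fix s assume s: "0 \<le> s" "s \<le> h"
    show "(?p has_real_derivative ?Dv (x + h *\<^sub>R w + s *\<^sub>R v) - ?Dv (x + s *\<^sub>R v)) (at s)"
      using box[OF s, of h] box[OF s, of 0] \<open>h > 0\<close>
      by (intro DERIV_diff line[OF S]) (auto simp: ac_simps)
  qed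
  then obtain s where s: "0 < s" "s < h"
    and sh: "?p h - ?p 0 = h * (?Dv (x + h *\<^sub>R w + s *\<^sub>R v) - ?Dv (x + s *\<^sub>R v))" by auto
  have "\<exists>t. 0 < t \<and> t < h \<and> ?Dv ((x + s *\<^sub>R v) + h *\<^sub>R w) - ?Dv ((x + s *\<^sub>R v) + 0 *\<^sub>R w) =
      (h - 0) * frechet_derivative ?Dv (at ((x + s *\<^sub>R v) + t *\<^sub>R w)) w"
  proof (rule MVT2[OF \<open>h > 0\<close>])
    fix t assume t: "0 \<le> t" "t \<le> h"
    show "((\<lambda>t. ?Dv ((x + s *\<^sub>R v) + t *\<^sub>R w)) has_real_derivative
        frechet_derivative ?Dv (at ((x + s *\<^sub>R v) + t *\<^sub>R w)) w) (at t)"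
      using box[of s t] t s by (intro line smooth_on_deriv[OF S]) auto
  qed
  then obtain t where "0 < t" "t < h"
    and "?Dv (x + s *\<^sub>R v + h *\<^sub>R w) - ?Dv (x + s *\<^sub>R v) =
      h * frechet_derivative ?Dv (at (x + s *\<^sub>R v + t *\<^sub>R w)) w" by auto
  then show ?thesis
    using s sh by (intro exI[of _ s] exI[of _ t]) (simp add: ac_simps power2_eq_square)
qed

text \<open>The second difference is symmetric in v and w, so by \<open>second_difference\<close>
  the two mixed derivatives agree at a pair of points arbitrarily close to x; continuity brings both
  points to x.\<close>

lemma iter_deriv_swap:
  fixes f :: "'a::real_normed_vector \<Rightarrow> real"
  assumes "open S" "smooth_on S f" "x \<in> S"
  shows "iter_deriv [v, w] f x = iter_deriv [w, v] f x"
proof (rule ccontr)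
  let ?A = "iter_deriv [v, w] f" and ?B = "iter_deriv [w, v] f"
  assume "?A x \<noteq> ?B x"
  define e where "e = \<bar>?A x - ?B x\<bar> / 2"
  have "e > 0" using \<open>?A x \<noteq> ?B x\<close> by (simp add: e_def)
  have cont: "isCont ?A x" "isCont ?B x"
    using assms smooth_on_continuous[OF smooth_on_iter_deriv[OF assms(2)]]
    by (metis continuous_on_eq_continuous_at)+
  obtain d1 where d1: "d1 > 0" "\<And>y. dist y x < d1 \<Longrightarrow> dist (?A y) (?A x) < e"
    using cont(1) \<open>e > 0\<close> unfolding continuous_at_eps_delta by blast
  obtain d2 where d2: "d2 > 0" "\<And>y. dist y x < d2 \<Longrightarrow> dist (?B y) (?B x) < e"
    using cont(2) \<open>e > 0\<close> unfolding continuous_at_eps_delta by blast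
  obtain d3 where d3: "d3 > 0" "\<And>y. dist y x < d3 \<Longrightarrow> y \<in> S"
    using assms(1,3) unfolding open_dist by blast
  \<comment> \<open>The step h keeps the parallelogram with sides h v and h w within d / 2 of x; the
    summand 1 in c avoids division by zero.\<close>
  define d c h where "d = min d1 (min d2 d3)" and "c = norm v + norm w + 1" and "h = d / (2 * c)"
  have pos: "c > 0" by (simp add: c_def add_nonneg_pos)
  have "d > 0" "h > 0" using d1 d2 d3 pos by (auto simp: d_def h_def)
  have hc: "h * c = d / 2" using pos by (simp add: h_def)
  have near: "dist (x + s *\<^sub>R v + t *\<^sub>R w) x < d"
    if "0 \<le> s" "s \<le> h" "0 \<le> t" "t \<le> h" for s t
  proof -
    have "dist (x + s *\<^sub>R v + t *\<^sub>R w) x = norm (s *\<^sub>R v + t *\<^sub>R w)"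
      by (simp add: dist_norm algebra_simps)
    also have "\<dots> \<le> norm (s *\<^sub>R v) + norm (t *\<^sub>R w)" by (rule norm_triangle_ineq)
    also have "\<dots> \<le> h * norm v + h * norm w" using that by (simp add: add_mono mult_right_mono)
    also have "\<dots> \<le> h * c" using \<open>h > 0\<close> by (simp add: c_def algebra_simps)
    also have "\<dots> < d" using \<open>d > 0\<close> hc by simp
    finally show ?thesis .
  qed
  have near': "dist (x + s *\<^sub>R w + t *\<^sub>R v) x < d"
    if "0 \<le> s" "s \<le> h" "0 \<le> t" "t \<le> h" for s t
    using near[OF that(3,4,1,2)] by (simp add: ac_simps)
  have inS: "y \<in> S" if "dist y x < d" for y using d3(2) that by (simp add: d_def)
  obtain s t where st: "0 \<le> s" "s \<le> h" "0 \<le> t" "t \<le> h"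
    "f (x + h *\<^sub>R v + h *\<^sub>R w) - f (x + h *\<^sub>R v) - f (x + h *\<^sub>R w) + f x =
      h\<^sup>2 * ?B (x + s *\<^sub>R v + t *\<^sub>R w)"
    using second_difference[OF assms(2) \<open>h > 0\<close>, of x v w, OF inS] near by blast
  obtain s' t' where st': "0 \<le> s'" "s' \<le> h" "0 \<le> t'" "t' \<le> h"
    "f (x + h *\<^sub>R w + h *\<^sub>R v) - f (x + h *\<^sub>R w) - f (x + h *\<^sub>R v) + f x =
      h\<^sup>2 * ?A (x + s' *\<^sub>R w + t' *\<^sub>R v)"
    using second_difference[OF assms(2) \<open>h > 0\<close>, of x w v, OF inS] near' by blast
  have comm: "x + h *\<^sub>R w + h *\<^sub>R v = x + h *\<^sub>R v + h *\<^sub>R w" by (simp add: ac_simps)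
  have "h\<^sup>2 * ?A (x + s' *\<^sub>R w + t' *\<^sub>R v) = h\<^sup>2 * ?B (x + s *\<^sub>R v + t *\<^sub>R w)"
    using st(5) st'(5) unfolding comm by linarith
  then have "?A (x + s' *\<^sub>R w + t' *\<^sub>R v) = ?B (x + s *\<^sub>R v + t *\<^sub>R w)"
    using \<open>h > 0\<close> by simp
  moreover have "dist (?A (x + s' *\<^sub>R w + t' *\<^sub>R v)) (?A x) < e"
    using near'[OF st'(1-4)] by (intro d1) (simp add: d_def)
  moreover have "dist (?B (x + s *\<^sub>R v + t *\<^sub>R w)) (?B x) < e"
    using near[OF st(1-4)] by (intro d2) (simp add: d_def)
  ultimately have "dist (?A x) (?B x) < 2 * e"
    using dist_triangle3[of "?A x" "?B x" "?B (x + s *\<^sub>R v + t *\<^sub>R w)"] by simp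
  then show False by (simp add: e_def dist_real_def)
qed

text \<open>Adjacent swaps bring an entry to the head. The claim ranges over all points of
  \<open>S\<close>, since an equality at a single point cannot be differentiated again.\<close>

lemma iter_deriv_perm:
  fixes f :: "'a::real_normed_vector \<Rightarrow> real"
  assumes "open S" "smooth_on S f"
  shows "mset vs = mset ws \<Longrightarrow> x \<in> S \<Longrightarrow> iter_deriv vs f x = iter_deriv ws f x"
proof (induction vs arbitrary: ws x)
  case (Cons v vs)
  have move: "iter_deriv (as @ v # bs) f x = iter_deriv (v # as @ bs) f x" if "x \<in> S" for as bs x
    using that
  proof (induction as arbitrary: x)
    case (Cons a as)
    have "frechet_derivative (iter_deriv (as @ v # bs) f) (at x) =
        frechet_derivative (iter_deriv (v # as @ bs) f) (at x)"
    proof (rule frechet_derivative_transform_within_open[OF _ assms(1) Cons.prems Cons.IH])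
      show "iter_deriv (as @ v # bs) f differentiable (at x)"
        using smooth_on_has_derivative[OF smooth_on_iter_deriv[OF assms(2)] Cons.prems]
        by (auto simp: differentiable_def)
    qed
    then have "iter_deriv ((a # as) @ v # bs) f x = iter_deriv [a, v] (iter_deriv (as @ bs) f) x"
      by (simp add: iter_deriv_append)
    also have "\<dots> = iter_deriv [v, a] (iter_deriv (as @ bs) f) x"
      by (rule iter_deriv_swap[OF assms(1) smooth_on_iter_deriv[OF assms(2)] Cons.prems])
    finally show ?case by simp
  qed simp
  obtain as bs where ws: "ws = as @ v # bs"
    using Cons.prems(1) by (metis list.set_intros(1) set_mset_mset split_list)
  then have "mset vs = mset (as @ bs)" using Cons.prems(1) by simp
  then have eq: "iter_deriv vs f y = iter_deriv (as @ bs) f y" if "y \<in> S" for y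
    using Cons.IH that by blast
  have "frechet_derivative (iter_deriv vs f) (at x) = frechet_derivative (iter_deriv (as @ bs) f) (at x)"
  proof (rule frechet_derivative_transform_within_open[OF _ assms(1) Cons.prems(2) eq])
    show "iter_deriv vs f differentiable (at x)"
      using smooth_on_has_derivative[OF smooth_on_iter_deriv[OF assms(2)] Cons.prems(2)]
      by (auto simp: differentiable_def)
  qed
  then have "iter_deriv (v # vs) f x = iter_deriv (v # as @ bs) f x" by simp
  also have "\<dots> = iter_deriv ws f x" unfolding ws by (rule move[OF Cons.prems(2), symmetric])
  finally show ?case .
qed simp

text \<open>All derivatives of f at x in one function on multisets. By
  \<open>iter_deriv_perm\<close> the chosen enumeration does not matter for f smooth on an open set
  around x.\<close>

definition jet :: "('a::real_normed_vector \<Rightarrow> real) \<Rightarrow> 'a \<Rightarrow> 'a multiset \<Rightarrow> real" where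
  "jet f x M = iter_deriv (SOME vs. mset vs = M) f x"

lemma jet_mset:
  assumes "open S" "smooth_on S f" "x \<in> S"
  shows "jet f x (mset vs) = iter_deriv vs f x"
proof -
  have "mset (SOME ws. mset ws = mset vs) = mset vs" by (rule someI) simp
  then show ?thesis unfolding jet_def by (rule iter_deriv_perm[OF assms(1,2) _ assms(3)])
qed

lemma jet_replicate:
  assumes "open S" "smooth_on S f" "x \<in> S"
  shows "jet f x (replicate_mset k v) = iter_deriv (replicate k v) f x"
  using jet_mset[OF assms, of "replicate k v"] by simp

lemma symmetric_multilinear_jet:
  assumes "open S" "smooth_on S f" "x \<in> S"
  shows "symmetric_multilinear (jet f x)"
proof
  fix u v :: 'a and M :: "'a multiset" and r :: real
  obtain vs where M: "M = mset vs" using ex_mset by metis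
  have eq: "jet f x (add_mset w M) = frechet_derivative (iter_deriv vs f) (at x) w" for w
    using jet_mset[OF assms, of "w # vs"] by (simp add: M)
  have "linear (frechet_derivative (iter_deriv vs f) (at x))"
    by (rule smooth_on_linear[OF smooth_on_iter_deriv[OF assms(2)] assms(3)])
  then show "jet f x (add_mset (u + v) M) = jet f x (add_mset u M) + jet f x (add_mset v M)"
    "jet f x (add_mset (r *\<^sub>R u) M) = r * jet f x (add_mset u M)"
    by (simp_all add: eq linear_add linear_scale)
qed

section \<open>Taylor expansion\<close>

lemma iter_deriv_line:
  assumes "smooth_on S f" "x + t *\<^sub>R h \<in> S"
  shows "((\<lambda>t. iter_deriv (replicate k h) f (x + t *\<^sub>R h)) has_real_derivative
    iter_deriv (replicate (Suc k) h) f (x + t *\<^sub>R h)) (at t)"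
proof -
  let ?g = "iter_deriv (replicate k h) f"
  have g: "smooth_on S ?g" by (rule smooth_on_iter_deriv[OF assms(1)])
  have "((\<lambda>t. ?g (x + t *\<^sub>R h)) has_derivative
      (\<lambda>r. frechet_derivative ?g (at (x + t *\<^sub>R h)) (r *\<^sub>R h))) (at t)"
    by (intro has_derivative_compose[of "\<lambda>s. x + s *\<^sub>R h" _ t _ ?g]
        smooth_on_has_derivative[OF g] assms)
      (auto intro!: derivative_eq_intros)
  then show ?thesis
    unfolding has_field_derivative_def
    by (rule has_derivative_eq_rhs)
      (simp add: fun_eq_iff linear_scale[OF smooth_on_linear[OF g assms(2)]])
qed

lemma taylor_term_eq_iter_deriv:
  assumes "open S" "smooth_on S f" "x \<in> S"
  shows "taylor_term k f x h = iter_deriv (replicate k h) f x / fact k"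
proof -
  \<comment> \<open>Proved at all t on the line inside \<open>S\<close>, because the next
    \<open>deriv\<close> looks at a neighbourhood.\<close>
  have "(deriv ^^ k) (\<lambda>t. f (x + t *\<^sub>R h)) t = iter_deriv (replicate k h) f (x + t *\<^sub>R h)"
    if "t \<in> {t. x + t *\<^sub>R h \<in> S}" for t
    using that
  proof (induction k arbitrary: t)
    case (Suc k)
    have "eventually (\<lambda>t. t \<in> {t. x + t *\<^sub>R h \<in> S}) (nhds t)"
      using eventually_nhds_in_open[OF open_line[OF assms(1)] Suc.prems] .
    then have "deriv ((deriv ^^ k) (\<lambda>t. f (x + t *\<^sub>R h))) t =
        deriv (\<lambda>t. iter_deriv (replicate k h) f (x + t *\<^sub>R h)) t"
      by (intro deriv_cong_ev) (auto elim!: eventually_mono simp: Suc.IH)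
    also have "\<dots> = iter_deriv (replicate (Suc k) h) f (x + t *\<^sub>R h)"
      using Suc.prems by (intro DERIV_imp_deriv iter_deriv_line[OF assms(2)]) auto
    finally show ?case by simp
  qed simp
  from this[of 0] assms show ?thesis by (simp add: taylor_term_def)
qed

text \<open>Joint continuity, because both point and direction move in the limit taken below. By
  symmetry one direction is made innermost and expanded in the basis, so the induction passes to the
  partial derivatives of f.\<close>

lemma continuous_iter_deriv_replicate:
  fixes f :: "'a::euclidean_space \<Rightarrow> real"
  assumes "open S"
  shows "smooth_on S f \<Longrightarrow>
    continuous_on (S \<times> UNIV) (\<lambda>p. iter_deriv (replicate k (snd p)) f (fst p))"
proof (induction k arbitrary: f)
  case 0
  have "continuous_on (S \<times> UNIV) (\<lambda>p. f (fst p))"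
    by (rule continuous_on_compose2[OF smooth_on_continuous[OF 0] continuous_on_fst[OF continuous_on_id]])
      auto
  then show ?case by simp
next
  case (Suc k)
  have eq: "(\<Sum>i\<in>Basis. (v \<bullet> i) * iter_deriv (replicate k v) (\<lambda>x. frechet_derivative f (at x) i) x) =
      iter_deriv (replicate (Suc k) v) f x" if "x \<in> S" for x v
  proof -
    interpret symmetric_multilinear "jet f x"
      by (rule symmetric_multilinear_jet[OF assms Suc.prems that])
    have move: "iter_deriv (replicate k v) (\<lambda>x. frechet_derivative f (at x) i) x =
        jet f x (add_mset i (replicate_mset k v))" for i
      using jet_mset[OF assms Suc.prems that, of "replicate k v @ [i]"] by (simp add: iter_deriv_append)
    then have "(\<Sum>i\<in>Basis. (v \<bullet> i) * iter_deriv (replicate k v) (\<lambda>x. frechet_derivative f (at x) i) x) =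
        jet f x (add_mset (\<Sum>i\<in>Basis. (v \<bullet> i) *\<^sub>R i) (replicate_mset k v))"
      by (simp only: sum move)
    also have "\<dots> = jet f x (replicate_mset (Suc k) v)" by (simp add: euclidean_representation)
    finally show ?thesis by (simp only: jet_replicate[OF assms Suc.prems that])
  qed
  have "continuous_on (S \<times> UNIV) (\<lambda>p. \<Sum>i\<in>Basis. (snd p \<bullet> i) *
      iter_deriv (replicate k (snd p)) (\<lambda>x. frechet_derivative f (at x) i) (fst p))"
    by (rule continuous_on_sum, rule continuous_on_mult,
        rule continuous_on_inner[OF continuous_on_snd[OF continuous_on_id] continuous_on_const],
        rule Suc.IH[OF smooth_on_deriv[OF Suc.prems]])
  then show ?case by (rule continuous_on_eq) (auto simp only: eq mem_Times_iff)
qed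

text \<open>Lagrange's remainder turns \<open>f (c t) = 0\<close> into the vanishing of an \<open>n\<close>-th derivative at a nearby
  point in the direction of the difference quotient of \<open>c\<close>; then let \<open>t \<rightarrow> 0\<close>.\<close>

lemma leading_term_zero_along_curve:
  fixes f :: "'a::euclidean_space \<Rightarrow> real"
  assumes "open S" "smooth_on S f" "x \<in> S"
    and low: "\<And>h j. j < n \<Longrightarrow> iter_deriv (replicate j h) f x = 0"
    and c: "c 0 = x" "(c has_vector_derivative v) (at 0)"
    and zero: "eventually (\<lambda>t. f (c t) = 0) (at_right 0)"
  shows "iter_deriv (replicate n v) f x = 0"
proof (cases "n = 0")
  \<comment> \<open>Lagrange's remainder needs positive order; here continuity of f
    suffices.\<close>
  case True
  have "(c \<longlongrightarrow> x) (at_right 0)"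
    using has_vector_derivative_continuous[OF c(2)] c(1)
    by (simp add: continuous_at filterlim_at_split)
  moreover have "isCont f x"
    using assms(1-3) smooth_on_continuous continuous_on_eq_continuous_at by blast
  ultimately have "((\<lambda>t. f (c t)) \<longlongrightarrow> f x) (at_right 0)" using isCont_tendsto_compose by blast
  then have "f x = 0"
    using tendsto_eventually[OF zero] by (rule tendsto_unique[OF trivial_limit_at_right_real])
  then show ?thesis using True by simp
next
  case False
  define q where "q t = (1 / t) *\<^sub>R (c t - x)" for t
  obtain r where r: "r > 0" "ball x r \<subseteq> S" using assms(1,3) open_contains_ball by blast
  have "(c \<longlongrightarrow> x) (at 0)"
    using has_vector_derivative_continuous[OF c(2)] c(1) unfolding continuous_at by simp
  then have cr: "(c \<longlongrightarrow> x) (at_right 0)" by (simp add: filterlim_at_split)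
  have "(q \<longlongrightarrow> v) (at 0)"
  proof -
    have "((\<lambda>h. norm (c (0 + h) - c 0 - h *\<^sub>R v) / norm h) \<longlongrightarrow> 0) (at 0)"
      using c(2) unfolding has_vector_derivative_def has_derivative_at by blast
    then have "((\<lambda>t. norm (q t - v)) \<longlongrightarrow> 0) (at 0)"
    proof (rule Lim_transform_eventually)
      show "eventually (\<lambda>t. norm (c (0 + t) - c 0 - t *\<^sub>R v) / norm t = norm (q t - v)) (at 0)"
        unfolding eventually_at_filter
      proof (intro always_eventually allI impI)
        fix t :: real assume "t \<noteq> 0"
        then have "q t - v = (1 / t) *\<^sub>R (c (0 + t) - c 0 - t *\<^sub>R v)"
          by (simp add: q_def c(1) scaleR_diff_right)
        then show "norm (c (0 + t) - c 0 - t *\<^sub>R v) / norm t = norm (q t - v)"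
          by (simp add: divide_inverse)
      qed
    qed
    from LIM_zero_cancel[OF tendsto_norm_zero_cancel[OF this]] show ?thesis .
  qed
  then have qr: "(q \<longlongrightarrow> v) (at_right 0)" by (simp add: filterlim_at_split)
  have "eventually (\<lambda>t. c t \<in> ball x r) (at_right 0)"
    using topological_tendstoD[OF cr, of "ball x r"] r(1) by simp
  then have "eventually (\<lambda>t. \<exists>s. 0 \<le> s \<and> s \<le> 1 \<and> x + s *\<^sub>R (c t - x) \<in> S \<and>
      iter_deriv (replicate n (q t)) f (x + s *\<^sub>R (c t - x)) = 0) (at_right 0)"
    using zero eventually_at_right_less[of 0]
  proof eventually_elim
    case (elim t)
    let ?k = "c t - x"
    have seg: "x + s *\<^sub>R ?k \<in> S" if "0 \<le> s" "s \<le> 1" for s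
    proof -
      have "norm (s *\<^sub>R ?k) \<le> norm ?k" using that by (simp add: mult_left_le_one_le)
      also have "\<dots> < r" using elim by (simp add: dist_norm norm_minus_commute)
      finally show ?thesis using r(2) by (auto simp: dist_norm)
    qed
    have "\<exists>s>0. s < 1 \<and> f (x + 1 *\<^sub>R ?k) =
        (\<Sum>m<n. iter_deriv (replicate m ?k) f (x + 0 *\<^sub>R ?k) / fact m * 1 ^ m) +
        iter_deriv (replicate n ?k) f (x + s *\<^sub>R ?k) / fact n * 1 ^ n"
    proof (rule Maclaurin[where f = "\<lambda>t. f (x + t *\<^sub>R ?k)"
          and diff = "\<lambda>m t. iter_deriv (replicate m ?k) f (x + t *\<^sub>R ?k)"])
      show "\<forall>m t. m < n \<and> 0 \<le> t \<and> t \<le> 1 \<longrightarrow>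
          ((\<lambda>t. iter_deriv (replicate m ?k) f (x + t *\<^sub>R ?k)) has_real_derivative
            iter_deriv (replicate (Suc m) ?k) f (x + t *\<^sub>R ?k)) (at t)"
        by (intro allI impI, rule iter_deriv_line[OF assms(2)], rule seg) auto
    qed (use False in auto)
    then obtain s where s: "s > 0" "s < 1"
      and "f (x + 1 *\<^sub>R ?k) = (\<Sum>m<n. iter_deriv (replicate m ?k) f (x + 0 *\<^sub>R ?k) / fact m * 1 ^ m) +
        iter_deriv (replicate n ?k) f (x + s *\<^sub>R ?k) / fact n * 1 ^ n" by blast
    then have 0: "iter_deriv (replicate n ?k) f (x + s *\<^sub>R ?k) = 0" using elim low by simp
    have y: "x + s *\<^sub>R ?k \<in> S" using seg s by simp
    interpret symmetric_multilinear "jet f (x + s *\<^sub>R ?k)"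
      by (rule symmetric_multilinear_jet[OF assms(1,2) y])
    \<comment> \<open>Homogeneity of degree n replaces the increment by the difference quotient,
      which tends to v.\<close>
    have "iter_deriv (replicate n (q t)) f (x + s *\<^sub>R ?k) = 0"
      using replicate_scale[of n "1 / t" ?k "{#}"] 0
      by (simp add: q_def jet_replicate[OF assms(1,2) y])
    with s y show ?case by (intro exI[of _ s]) simp
  qed
  then have "\<exists>s. eventually (\<lambda>t. 0 \<le> s t \<and> s t \<le> 1 \<and> x + s t *\<^sub>R (c t - x) \<in> S \<and>
      iter_deriv (replicate n (q t)) f (x + s t *\<^sub>R (c t - x)) = 0) (at_right 0)"
    by (rule iffD1[OF eventually_ex])
  then obtain s where s: "eventually (\<lambda>t. 0 \<le> s t \<and> s t \<le> 1 \<and> x + s t *\<^sub>R (c t - x) \<in> S \<and>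
      iter_deriv (replicate n (q t)) f (x + s t *\<^sub>R (c t - x)) = 0) (at_right 0)" ..
  have "((\<lambda>t. s t *\<^sub>R (c t - x)) \<longlongrightarrow> 0) (at_right 0)"
  proof (rule Lim_null_comparison)
    show "eventually (\<lambda>t. norm (s t *\<^sub>R (c t - x)) \<le> norm (c t - x)) (at_right 0)"
      using s by eventually_elim (simp add: mult_left_le_one_le)
    show "((\<lambda>t. norm (c t - x)) \<longlongrightarrow> 0) (at_right 0)"
      using tendsto_norm[OF tendsto_diff[OF cr tendsto_const[of x]]] by simp
  qed
  from tendsto_add[OF tendsto_const[of x] this]
  have "((\<lambda>t. x + s t *\<^sub>R (c t - x)) \<longlongrightarrow> x) (at_right 0)" by simp
  from tendsto_Pair[OF this qr]
  have pair: "((\<lambda>t. (x + s t *\<^sub>R (c t - x), q t)) \<longlongrightarrow> (x, v)) (at_right 0)" .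
  have "isCont (\<lambda>p. iter_deriv (replicate n (snd p)) f (fst p)) (x, v)"
    using continuous_iter_deriv_replicate[OF assms(1,2), of n] assms(1,3)
    by (simp add: continuous_on_eq_continuous_at open_Times)
  from isCont_tendsto_compose[OF this pair]
  have "((\<lambda>t. iter_deriv (replicate n (q t)) f (x + s t *\<^sub>R (c t - x)))
      \<longlongrightarrow> iter_deriv (replicate n v) f x) (at_right 0)" by simp
  moreover have "eventually (\<lambda>t. iter_deriv (replicate n (q t)) f (x + s t *\<^sub>R (c t - x)) = 0) (at_right 0)"
    using s by eventually_elim simp
  ultimately show ?thesis
    by (rule tendsto_unique[OF trivial_limit_at_right_real _ tendsto_eventually])
qed

section \<open>Charts and tangent vectors\<close>

locale manifold =
  fixes X :: "'m topology" and A :: "('m, 'n::finite) chart set"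
  assumes manifold: "smooth_manifold X A"
begin

lemma chart:
  assumes "c \<in> A"
  shows "openin X (fst c)" "open (snd c ` fst c)"
    "homeomorphic_map (subtopology X (fst c)) (top_of_set (snd c ` fst c)) (snd c)"
  using manifold assms unfolding smooth_manifold_def is_chart_def by auto

lemma topspace_chart: "c \<in> A \<Longrightarrow> topspace (subtopology X (fst c)) = fst c"
  using openin_subset[OF chart(1)] by (simp add: inf.absorb2)

lemma inj_chart: "c \<in> A \<Longrightarrow> inj_on (snd c) (fst c)"
  using homeomorphic_imp_injective_map[OF chart(3)] topspace_chart by metis

lemma param_coord: "c \<in> A \<Longrightarrow> q \<in> fst c \<Longrightarrow> param c (snd c q) = q"
  by (simp add: param_def inv_into_f_f inj_chart)

lemma coord_param: "x \<in> snd c ` fst c \<Longrightarrow> snd c (param c x) = x"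
  by (simp add: param_def f_inv_into_f)

lemma param_in: "x \<in> snd c ` fst c \<Longrightarrow> param c x \<in> fst c"
  by (simp add: param_def inv_into_into)

lemma open_chart_image:
  assumes "c \<in> A" "openin X W"
  shows "open (snd c ` (fst c \<inter> W))"
proof -
  have "openin (subtopology X (fst c)) (fst c \<inter> W)"
    using assms(2) by (simp add: openin_subtopology_Int2)
  then have "openin (top_of_set (snd c ` fst c)) (snd c ` (fst c \<inter> W))"
    using homeomorphic_imp_open_map[OF chart(3)[OF assms(1)]] unfolding open_map_def by blast
  then show ?thesis using chart(2)[OF assms(1)] openin_open_trans by blast
qed

lemma open_overlap: "c \<in> A \<Longrightarrow> d \<in> A \<Longrightarrow> open (snd c ` (fst c \<inter> fst d))"
  using open_chart_image chart(1) by blast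

lemma continuous_param:
  assumes "c \<in> A"
  shows "continuous_map (top_of_set (snd c ` fst c)) X (param c)"
proof -
  obtain h where h: "homeomorphic_maps (subtopology X (fst c)) (top_of_set (snd c ` fst c)) (snd c) h"
    using chart(3)[OF assms] by (auto simp: homeomorphic_map_maps)
  then have "continuous_map (top_of_set (snd c ` fst c)) (subtopology X (fst c)) h"
    by (simp add: homeomorphic_maps_def)
  then have "continuous_map (top_of_set (snd c ` fst c)) X h"
    by (rule continuous_map_into_fulltopology)
  moreover have "h x = param c x" if "x \<in> topspace (top_of_set (snd c ` fst c))" for x
    using h that topspace_chart[OF assms] param_coord[OF assms]
    by (auto simp: homeomorphic_maps_def)
  ultimately show ?thesis by (rule continuous_map_eq)
qed

lemma transition: "c \<in> A \<Longrightarrow> d \<in> A \<Longrightarrow> smooth_on (snd c ` (fst c \<inter> fst d)) (snd d \<circ> param c)"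
  using manifold by (auto simp: smooth_manifold_def compatible_def smooth_transition_def)

lemma smooth_in_chart:
  assumes "smooth_fun_at X A p f" "c \<in> A" "p \<in> fst c"
  obtains S where "open S" "snd c p \<in> S" "smooth_on S (f \<circ> param c)"
proof -
  obtain W where "openin X W" "p \<in> W" "smooth_fun_on A W f"
    using assms(1) by (auto simp: smooth_fun_at_def)
  then show ?thesis
    using that[of "snd c ` (fst c \<inter> W)"] assms(2,3) open_chart_image
    by (auto simp: smooth_fun_on_def)
qed

text \<open>The tangent vector with components v in the chart c. It has the same default value 0 as
  \<open>velocity\<close>, so the two can be equal as operators on all functions.\<close>

definition tvec :: "('m, 'n) chart \<Rightarrow> real^'n \<Rightarrow> real^'n \<Rightarrow> 'm tvec" where
  "tvec c x v = (\<lambda>f. if smooth_fun_at X A (param c x) f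
     then frechet_derivative (f \<circ> param c) (at x) v else 0)"

text \<open>The chain rule uses only the derivative at 0 of the curve read in c, so it also covers
  curves defined through another chart.\<close>

lemma velocity_eq_tvec:
  assumes "c \<in> A" "\<gamma> 0 \<in> fst c" and near: "eventually (\<lambda>t. \<gamma> t \<in> fst c) (nhds 0)"
    and der: "((\<lambda>t. snd c (\<gamma> t)) has_vector_derivative v) (at 0)"
  shows "velocity X A \<gamma> = tvec c (snd c (\<gamma> 0)) v"
proof
  fix f
  have p: "param c (snd c (\<gamma> 0)) = \<gamma> 0" using assms param_coord by blast
  show "velocity X A \<gamma> f = tvec c (snd c (\<gamma> 0)) v f"
  proof (cases "smooth_fun_at X A (\<gamma> 0) f")
    case True
    then obtain S where S: "open S" "snd c (\<gamma> 0) \<in> S" "smooth_on S (f \<circ> param c)"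
      using smooth_in_chart assms(1,2) by blast
    let ?F = "frechet_derivative (f \<circ> param c) (at (snd c (\<gamma> 0)))"
    have lin: "linear ?F" using smooth_on_linear[OF S(3,2)] .
    have "((\<lambda>t. (f \<circ> param c) (snd c (\<gamma> t))) has_derivative (\<lambda>h. ?F (h *\<^sub>R v))) (at 0)"
      using has_derivative_compose[OF der[unfolded has_vector_derivative_def]
          smooth_on_has_derivative[OF S(3,2)]] .
    then have "((\<lambda>t. (f \<circ> param c) (snd c (\<gamma> t))) has_real_derivative ?F v) (at 0)"
      unfolding has_field_derivative_def
      by (rule has_derivative_eq_rhs) (simp add: fun_eq_iff linear_scale[OF lin])
    then have "deriv (\<lambda>t. (f \<circ> param c) (snd c (\<gamma> t))) 0 = ?F v" by (rule DERIV_imp_deriv)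
    moreover have "deriv (f \<circ> \<gamma>) 0 = deriv (\<lambda>t. (f \<circ> param c) (snd c (\<gamma> t))) 0"
      by (rule deriv_cong_ev[OF _ refl], rule eventually_mono[OF near])
        (simp add: param_coord[OF assms(1)])
    ultimately show ?thesis using True by (simp add: velocity_def tvec_def p)
  qed (simp add: velocity_def tvec_def p)
qed

lemma line_in_chart:
  assumes "c \<in> A" "x \<in> snd c ` fst c"
  shows "eventually (\<lambda>t. x + t *\<^sub>R v \<in> snd c ` fst c) (nhds (0::real))"
  using eventually_nhds_in_open[OF open_line[OF chart(2)[OF assms(1)]], of 0 x v] assms(2) by simp

lemma smooth_curve_line:
  assumes "c \<in> A" "x \<in> snd c ` fst c"
  shows "smooth_curve_at X A (param c x) (\<lambda>t. param c (x + t *\<^sub>R v))"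
proof -
  let ?U = "snd c ` fst c" and ?\<gamma> = "\<lambda>t. param c (x + t *\<^sub>R v)"
  have "open {t. x + t *\<^sub>R v \<in> ?U}" "0 \<in> {t. x + t *\<^sub>R v \<in> ?U}"
    using open_line[OF chart(2)[OF assms(1)]] assms(2) by auto
  then obtain e where e: "e > 0" "ball 0 e \<subseteq> {t. x + t *\<^sub>R v \<in> ?U}"
    using open_contains_ball by blast
  have I: "x + t *\<^sub>R v \<in> ?U" if "t \<in> {-e<..<e}" for t
    using e(2) that by (auto simp: subset_iff dist_real_def abs_less_iff)
  have "continuous_map (top_of_set {-e<..<e}) (top_of_set ?U) (\<lambda>t. x + t *\<^sub>R v)"
    using I by (auto simp: continuous_map_in_subtopology intro!: continuous_intros)
  then have "continuous_map (top_of_set {-e<..<e}) X (param c \<circ> (\<lambda>t. x + t *\<^sub>R v))"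
    using continuous_param[OF assms(1)] by (rule continuous_map_compose)
  then have cont: "continuous_map (top_of_set {-e<..<e}) X ?\<gamma>" by (simp add: comp_def)
  have "smooth_on {t \<in> {-e<..<e}. ?\<gamma> t \<in> fst d} (snd d \<circ> ?\<gamma>)" if "d \<in> A" for d
  proof -
    let ?S = "snd c ` (fst c \<inter> fst d)"
    have "smooth_on {t. x + t *\<^sub>R v \<in> ?S} (\<lambda>t. (snd d \<circ> param c) (x + t *\<^sub>R v))"
      using Ck_on_line[OF open_overlap[OF assms(1) that]] transition[OF assms(1) that]
      unfolding smooth_on_def by blast
    moreover have "{t \<in> {-e<..<e}. ?\<gamma> t \<in> fst d} \<subseteq> {t. x + t *\<^sub>R v \<in> ?S}"
    proof clarify
      fix t assume t: "t \<in> {-e<..<e}" "?\<gamma> t \<in> fst d"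
      then have "x + t *\<^sub>R v = snd c (?\<gamma> t)" "?\<gamma> t \<in> fst c"
        using I[OF t(1)] coord_param param_in by metis+
      then show "x + t *\<^sub>R v \<in> ?S" using t(2) by blast
    qed
    ultimately show ?thesis unfolding comp_def by (rule smooth_on_subset)
  qed
  with e(1) cont show ?thesis by (auto simp: smooth_curve_at_def)
qed

lemma velocity_line:
  assumes "c \<in> A" "x \<in> snd c ` fst c"
  shows "velocity X A (\<lambda>t. param c (x + t *\<^sub>R v)) = tvec c x v"
proof -
  let ?\<gamma> = "\<lambda>t. param c (x + t *\<^sub>R v)"
  note ev = line_in_chart[OF assms, of v]
  have x: "snd c (?\<gamma> 0) = x" using coord_param[OF assms(2)] by simp
  have "((\<lambda>t. x + t *\<^sub>R v) has_vector_derivative v) (at 0)"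
    unfolding has_vector_derivative_def by (auto intro!: derivative_eq_intros)
  moreover have "eventually (\<lambda>t. x + t *\<^sub>R v = snd c (?\<gamma> t)) (nhds 0)"
    using ev by eventually_elim (simp add: coord_param)
  ultimately have der: "((\<lambda>t. snd c (?\<gamma> t)) has_vector_derivative v) (at 0)"
    unfolding has_vector_derivative_def
    by (rule_tac has_derivative_transform_eventually[of "\<lambda>t. x + t *\<^sub>R v"])
      (auto simp: eventually_nhds_conv_at)
  have near: "eventually (\<lambda>t. ?\<gamma> t \<in> fst c) (nhds 0)"
    using ev by eventually_elim (rule param_in)
  have "velocity X A ?\<gamma> = tvec c (snd c (?\<gamma> 0)) v"
    by (rule velocity_eq_tvec[OF assms(1) _ near der]) (use param_in[OF assms(2)] in simp)
  then show ?thesis unfolding x .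
qed

lemma tangent_space_eq:
  assumes "c \<in> A" "p \<in> fst c"
  shows "tangent_space X A p = range (tvec c (snd c p))"
proof
  let ?x = "snd c p"
  have x: "?x \<in> snd c ` fst c" "param c ?x = p" using assms param_coord by auto
  have "tvec c ?x v \<in> tangent_space X A p" for v
    unfolding tangent_space_def
    using velocity_line[OF assms(1) x(1), of v] smooth_curve_line[OF assms(1) x(1), of v, unfolded x(2)]
    by (intro CollectI exI[of _ "\<lambda>t. param c (?x + t *\<^sub>R v)"]) simp
  then show "range (tvec c ?x) \<subseteq> tangent_space X A p" by (rule image_subsetI)
  show "tangent_space X A p \<subseteq> range (tvec c ?x)"
  proof
    fix u assume "u \<in> tangent_space X A p"
    then obtain \<gamma> where u: "u = velocity X A \<gamma>" and "smooth_curve_at X A p \<gamma>"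
      unfolding tangent_space_def by (elim CollectE exE conjE)
    then obtain e where \<gamma>: "\<gamma> 0 = p" "e > 0"
      and cont: "continuous_map (top_of_set {-e<..<e}) X \<gamma>"
      and sm: "\<forall>c\<in>A. smooth_on {t \<in> {-e<..<e}. \<gamma> t \<in> fst c} (snd c \<circ> \<gamma>)"
      unfolding smooth_curve_at_def by (elim exE conjE)
    note sm = bspec[OF sm assms(1)]
    let ?J = "{t \<in> {-e<..<e}. \<gamma> t \<in> fst c}"
    have "openin (top_of_set {-e<..<e}) ?J"
      using openin_continuous_map_preimage[OF cont chart(1)[OF assms(1)]]
      unfolding topspace_euclidean_subtopology .
    from openin_open_trans[OF this open_greaterThanLessThan] have "open ?J" .
    moreover have 0: "0 \<in> ?J" using \<gamma> assms by simp
    ultimately have "eventually (\<lambda>t. t \<in> ?J) (nhds 0)" by (rule eventually_nhds_in_open)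
    then have near: "eventually (\<lambda>t. \<gamma> t \<in> fst c) (nhds 0)" by (rule eventually_mono) simp
    define D where "D = frechet_derivative (snd c \<circ> \<gamma>) (at 0)"
    have "(snd c \<circ> \<gamma> has_derivative D) (at 0)"
      unfolding D_def by (rule smooth_on_has_derivative[OF sm 0])
    moreover have "D = (\<lambda>r. r *\<^sub>R D 1)"
    proof
      show "D r = r *\<^sub>R D 1" for r
        using linear_scale[OF smooth_on_linear[OF sm 0], of r 1] by (simp add: D_def)
    qed
    ultimately have "(snd c \<circ> \<gamma> has_derivative (\<lambda>r. r *\<^sub>R D 1)) (at 0)" by (rule has_derivative_eq_rhs)
    then have "((\<lambda>t. snd c (\<gamma> t)) has_vector_derivative D 1) (at 0)"
      unfolding has_vector_derivative_def comp_def .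
    from velocity_eq_tvec[OF assms(1) _ near this] show "u \<in> range (tvec c ?x)"
      using assms(2) \<gamma>(1) u by auto
  qed
qed

lemma tvec_linear:
  assumes "c \<in> A" "x \<in> snd c ` fst c"
  shows "tvec c x (u + v) = (\<lambda>f. tvec c x u f + tvec c x v f)"
    and "tvec c x (r *\<^sub>R u) = (\<lambda>f. r * tvec c x u f)"
proof -
  have lin: "linear (frechet_derivative (f \<circ> param c) (at x))"
    if f: "smooth_fun_at X A (param c x) f" for f
  proof -
    obtain S where "snd c (param c x) \<in> S" "smooth_on S (f \<circ> param c)"
      by (rule smooth_in_chart[OF f assms(1) param_in[OF assms(2)]])
    then show ?thesis using smooth_on_linear coord_param[OF assms(2)] by metis
  qed
  show "tvec c x (u + v) = (\<lambda>f. tvec c x u f + tvec c x v f)"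
    and "tvec c x (r *\<^sub>R u) = (\<lambda>f. r * tvec c x u f)"
    by (auto simp: tvec_def fun_eq_iff linear_add[OF lin] linear_scale[OF lin])
qed

text \<open>The vector is tested on the coordinate function of a nonzero component, which is smooth
  near the point. This makes the metric positive definite on components.\<close>

lemma tvec_nonzero:
  assumes "c \<in> A" "x \<in> snd c ` fst c" "v \<noteq> 0"
  shows "tvec c x v \<noteq> (\<lambda>f. 0)"
proof
  assume 0: "tvec c x v = (\<lambda>f. 0)"
  obtain i where i: "v $ i \<noteq> 0" using assms(3) by (auto simp: vec_eq_iff)
  let ?f = "\<lambda>q. snd c q $ i"
  have "smooth_on (snd d ` (fst d \<inter> fst c)) (?f \<circ> param d)" if "d \<in> A" for d
    using Ck_on_bounded_linear[OF open_overlap[OF that assms(1)] bounded_linear_vec_nth[of i]]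
      transition[OF that assms(1)]
    unfolding smooth_on_def comp_def by blast
  then have "smooth_fun_at X A (param c x) ?f"
    using chart(1)[OF assms(1)] param_in[OF assms(2)]
    unfolding smooth_fun_at_def smooth_fun_on_def by blast
  then have "frechet_derivative (?f \<circ> param c) (at x) v = 0"
    using fun_cong[OF 0, of ?f] by (simp add: tvec_def)
  moreover have "((?f \<circ> param c) has_derivative (\<lambda>v. v $ i)) (at x)"
    by (rule has_derivative_transform_within_open[OF
          bounded_linear_imp_has_derivative[OF bounded_linear_vec_nth[of i]]
          chart(2)[OF assms(1)] assms(2)])
      (simp add: coord_param)
  ultimately show False using i by (simp add: frechet_derivative_eqI)
qed

text \<open>A kernel vector \<open>h\<close> of \<open>l\<close> transverse to \<open>N\<close> would, together with the tangent directions of \<open>N\<close>,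
  span everything and force \<open>l e = 0\<close>; so \<open>h\<close> is tangent to \<open>N\<close>.\<close>

lemma hypersurface_curve:
  assumes N: "smooth_hypersurface X A N" and p: "p \<in> N" and c: "c \<in> A" "p \<in> fst c"
    and lin: "linear l" and e: "l e \<noteq> 0" and h: "l h = 0"
    and l: "\<And>v. tvec c (snd c p) v \<in> tangent_space_of X A N p \<Longrightarrow> l v = 0"
  obtains \<gamma> where "\<gamma> 0 = snd c p" "(\<gamma> has_vector_derivative h) (at 0)"
    "eventually (\<lambda>t. \<gamma> t \<in> snd c ` (fst c \<inter> N)) (nhds 0)"
proof -
  obtain d i where d: "d \<in> A" "p \<in> fst d"
    and slice: "snd d ` (fst d \<inter> N) = {x \<in> snd d ` fst d. x $ i = 0}"
    using N p unfolding smooth_hypersurface_def by blast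
  let ?x = "snd c p" and ?y = "snd d p"
  have y: "?y \<in> snd d ` fst d" "?y $ i = 0" "param d ?y = p"
    using d p slice param_coord by blast+
  have x: "param c ?x = p" using c param_coord by blast
  let ?\<phi> = "snd d \<circ> param c" and ?\<psi> = "snd c \<circ> param d"
  let ?D\<phi> = "frechet_derivative ?\<phi> (at ?x)" and ?D\<psi> = "frechet_derivative ?\<psi> (at ?y)"
  have \<phi>: "(?\<phi> has_derivative ?D\<phi>) (at ?x)"
    using smooth_on_has_derivative[OF transition[OF c(1) d(1)], of ?x] c(2) d(2) by simp
  have \<psi>: "(?\<psi> has_derivative ?D\<psi>) (at ?y)"
    using smooth_on_has_derivative[OF transition[OF d(1) c(1)], of ?y] c(2) d(2) by simp
  have lin\<psi>: "linear ?D\<psi>" using has_derivative_linear[OF \<psi>] .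
  have inv: "?D\<psi> (?D\<phi> v) = v" for v
  proof -
    have "(?\<psi> has_derivative ?D\<psi>) (at (?\<phi> ?x))" using \<psi> x by simp
    from has_derivative_compose[OF \<phi> this]
    have "((\<lambda>z. ?\<psi> (?\<phi> z)) has_derivative (\<lambda>v. ?D\<psi> (?D\<phi> v))) (at ?x)" .
    moreover have "((\<lambda>z. ?\<psi> (?\<phi> z)) has_derivative (\<lambda>v. v)) (at ?x)"
    proof (rule has_derivative_transform_within_open[OF has_derivative_ident open_overlap[OF c(1) d(1)]])
      fix z assume "z \<in> snd c ` (fst c \<inter> fst d)"
      then obtain q where q: "q \<in> fst c" "q \<in> fst d" "z = snd c q" by blast
      then show "z = ?\<psi> (?\<phi> z)"
        by (simp add: param_coord[OF c(1)] param_coord[OF d(1)])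
    qed (use c d in auto)
    ultimately have "(\<lambda>v. ?D\<psi> (?D\<phi> v)) = (\<lambda>v. v)" by (rule has_derivative_unique)
    then show ?thesis by (rule fun_cong)
  qed
  have curve: "((\<lambda>t. snd c (param d (?y + t *\<^sub>R w))) has_vector_derivative ?D\<psi> w) (at 0)" for w
  proof -
    have "((\<lambda>t. ?y + t *\<^sub>R w) has_derivative (\<lambda>t. t *\<^sub>R w)) (at 0)"
      by (auto intro!: derivative_eq_intros)
    moreover have "(?\<psi> has_derivative ?D\<psi>) (at (?y + 0 *\<^sub>R w))" using \<psi> by simp
    ultimately have "((\<lambda>t. ?\<psi> (?y + t *\<^sub>R w)) has_derivative (\<lambda>t. ?D\<psi> (t *\<^sub>R w))) (at 0)"
      by (rule has_derivative_compose)
    then show ?thesis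
      unfolding has_vector_derivative_def by (simp add: linear_scale[OF lin\<psi>])
  qed
  have in_c: "eventually (\<lambda>t. param d (?y + t *\<^sub>R w) \<in> fst c) (nhds (0::real))" for w
  proof -
    have "?y \<in> snd d ` (fst d \<inter> fst c)" using c d by blast
    then have "eventually (\<lambda>t. ?y + t *\<^sub>R w \<in> snd d ` (fst d \<inter> fst c)) (nhds (0::real))"
      using eventually_nhds_in_open[OF open_line[OF open_overlap[OF d(1) c(1)]], of 0 ?y w] by simp
    then show ?thesis
    proof eventually_elim
      case (elim t)
      then obtain q where "q \<in> fst d" "q \<in> fst c" "?y + t *\<^sub>R w = snd d q" by blast
      then show ?case by (simp add: param_coord[OF d(1)])
    qed
  qed
  have in_N: "eventually (\<lambda>t. param d (?y + t *\<^sub>R w) \<in> N) (nhds (0::real))" if "w $ i = 0" for w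
    using line_in_chart[OF d(1) y(1), of w]
  proof eventually_elim
    case (elim t)
    then have "?y + t *\<^sub>R w \<in> snd d ` (fst d \<inter> N)" using slice y(2) that by simp
    then obtain q where "q \<in> fst d" "q \<in> N" "?y + t *\<^sub>R w = snd d q" by blast
    then show ?case by (simp add: param_coord[OF d(1)])
  qed
  \<comment> \<open>A line inside the slice stays in \<open>N\<close>, so its velocity is tangent to
    \<open>N\<close>.\<close>
  have tangent: "l (?D\<psi> w) = 0" if "w $ i = 0" for w
  proof (rule l)
    let ?\<gamma> = "\<lambda>t. param d (?y + t *\<^sub>R w)"
    have "velocity X A ?\<gamma> = tvec c (snd c (?\<gamma> 0)) (?D\<psi> w)"
      by (rule velocity_eq_tvec[OF c(1) _ in_c curve]) (use y c in simp)
    moreover have "smooth_curve_at X A p ?\<gamma>" using smooth_curve_line[OF d(1) y(1)] y(3) by simp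
    ultimately show "tvec c ?x (?D\<psi> w) \<in> tangent_space_of X A N p"
      using in_N[OF that] y(3) unfolding tangent_space_of_def
      by (intro CollectI exI[of _ ?\<gamma>]) simp
  qed
  have "?D\<phi> h $ i = 0"
  proof (rule ccontr)
    assume nz: "?D\<phi> h $ i \<noteq> 0"
    \<comment> \<open>Chosen so that the i-th component of the combination below vanishes, which
      puts it in the slice.\<close>
    define r where "r = ?D\<phi> e $ i / ?D\<phi> h $ i"
    have "l (?D\<psi> (?D\<phi> e - r *\<^sub>R ?D\<phi> h)) = 0" by (rule tangent) (use nz in \<open>simp add: r_def\<close>)
    then have "l e = 0"
      using h by (simp add: linear_diff[OF lin\<psi>] linear_scale[OF lin\<psi>] inv
          linear_diff[OF lin] linear_scale[OF lin])
    with e show False ..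
  qed
  show ?thesis
  proof (rule that[of "\<lambda>t. snd c (param d (?y + t *\<^sub>R ?D\<phi> h))"])
    show "eventually (\<lambda>t. snd c (param d (?y + t *\<^sub>R ?D\<phi> h)) \<in> snd c ` (fst c \<inter> N)) (nhds 0)"
      using in_c in_N[OF \<open>?D\<phi> h $ i = 0\<close>] by eventually_elim blast
  qed (use curve[of "?D\<phi> h"] inv y(3) in auto)
qed

end

section \<open>The leading part of an eigenfunction\<close>

text \<open>The equation is differentiated n - 2 times at \<open>x\<close>. On the right only
  derivatives of order below n occur, all zero. On the left each coefficient multiplies a function
  vanishing to such an order that it may be frozen at \<open>x\<close>, so only the second-order
  part remains.\<close>

lemma leading_part_harmonic:
  fixes F :: "real^'n \<Rightarrow> real" and G :: "real^'n \<Rightarrow> real^'n^'n" and lam :: real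
  defines "w \<equiv> \<lambda>y. sqrt (det (G y))"
  assumes U: "open U" "x \<in> U" and F: "smooth_on U F"
    and G: "\<And>i j. smooth_on U (\<lambda>y. G y $ i $ j)" "\<And>y. y \<in> U \<Longrightarrow> det (G y) > 0"
    and eq: "\<And>y. y \<in> U \<Longrightarrow> (\<Sum>i\<in>UNIV. partial i
         (\<lambda>y. w y * (\<Sum>j\<in>UNIV. matrix_inv (G y) $ i $ j * partial j F y)) y) / w y = - lam * F y"
    and low: "\<And>vs. length vs < n \<Longrightarrow> iter_deriv vs F x = 0"
    and vs: "length vs + 2 = n"
  shows "(\<Sum>i\<in>UNIV. \<Sum>j\<in>UNIV. matrix_inv (G x) $ i $ j *
    iter_deriv (vs @ [axis i 1, axis j 1]) F x) = 0"
proof -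
  let ?K = "\<lambda>i j y. matrix_inv (G y) $ i $ j"
  define a where "a i j y = w y * ?K i j y" for i j y
  define H where "H i y = (\<Sum>j\<in>UNIV. a i j y * partial j F y)" for i y
  have wpos: "w y > 0" if "y \<in> U" for y using G(2)[OF that] by (simp add: w_def)
  have w: "smooth_on U w"
    unfolding w_def smooth_on_def
    by (intro allI Ck_on_sqrt[OF U(1) Ck_on_det[OF U(1) G(1)[unfolded smooth_on_def, rule_format]] G(2)])
  have K: "smooth_on U (?K i j)" for i j
    unfolding smooth_on_def
  proof
    fix k
    show "Ck_on k U (?K i j)"
      by (rule Ck_on_matrix_inv[OF U(1) G(1)[unfolded smooth_on_def, rule_format]])
        (use G(2) in force)
  qed
  have a: "smooth_on U (a i j)" for i j
    unfolding a_def[abs_def] by (rule smooth_on_mult[OF U(1) w K])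
  have dF: "smooth_on U (partial j F)" for j
    unfolding partial_def[abs_def] by (rule smooth_on_deriv[OF F])
  have aF: "smooth_on U (\<lambda>y. a i j y * partial j F y)" for i j
    by (rule smooth_on_mult[OF U(1) a dF])
  have H: "smooth_on U (H i)" for i
    unfolding H_def[abs_def] by (rule smooth_on_sum[OF U(1) aF])
  have dH: "smooth_on U (partial i (H i))" for i
    unfolding partial_def[abs_def] by (rule smooth_on_deriv[OF H])
  have H_eq: "(\<lambda>y. w y * (\<Sum>j\<in>UNIV. ?K i j y * partial j F y)) = H i" for i
    by (simp add: fun_eq_iff H_def a_def sum_distrib_left mult.assoc)
  have pde: "(\<Sum>i\<in>UNIV. partial i (H i) y) = - lam * w y * F y" if "y \<in> U" for y
    using eq[OF that, unfolded H_eq] wpos[OF that] by (simp add: divide_simps mult_ac)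
  have "iter_deriv vs (\<lambda>y. \<Sum>i\<in>UNIV. partial i (H i) y) x = iter_deriv vs (\<lambda>y. - lam * w y * F y) x"
    by (rule iter_deriv_cong[OF U(1) pde smooth_on_sum[OF U(1) dH] U(2)])
  also have "\<dots> = - lam * w x * iter_deriv vs F x"
    using low vs
    by (intro iter_deriv_mult_vanishing[OF U, where k = n] smooth_on_mult[OF U(1) smooth_on_const w] F)
      auto
  also have "\<dots> = 0" using low vs by simp
  finally have "(\<Sum>i\<in>UNIV. iter_deriv vs (partial i (H i)) x) = 0"
    by (simp add: iter_deriv_sum[OF U(1) dH U(2)])
  moreover have "iter_deriv vs (partial i (H i)) x =
      w x * (\<Sum>j\<in>UNIV. ?K i j x * iter_deriv (vs @ [axis i 1, axis j 1]) F x)" for i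
  proof -
    have "iter_deriv vs (partial i (H i)) x = iter_deriv (vs @ [axis i 1]) (H i) x"
      by (simp add: iter_deriv_append partial_def[abs_def])
    also have "\<dots> = (\<Sum>j\<in>UNIV. iter_deriv (vs @ [axis i 1]) (\<lambda>y. a i j y * partial j F y) x)"
      unfolding H_def[abs_def] by (rule iter_deriv_sum[OF U(1) aF U(2)])
    also have "\<dots> = (\<Sum>j\<in>UNIV. a i j x * iter_deriv (vs @ [axis i 1]) (partial j F) x)"
    \<comment> \<open>The partial derivatives of \<open>F\<close> vanish to order n - 1, which is
      exactly the length of \<open>vs @ [axis i 1]\<close>.\<close>
    proof (rule sum.cong[OF refl], rule iter_deriv_mult_vanishing[OF U a dF])
      fix j :: 'n and ws :: "(real^'n) list"
      assume "length ws < n - 1"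
      then show "iter_deriv ws (partial j F) x = 0"
        using low[of "ws @ [axis j 1]"] by (simp add: iter_deriv_append partial_def[abs_def])
    qed (use vs in simp)
    also have "\<dots> = (\<Sum>j\<in>UNIV. a i j x * iter_deriv (vs @ [axis i 1, axis j 1]) F x)"
      by (simp add: iter_deriv_append partial_def[abs_def])
    finally show ?thesis by (simp add: a_def sum_distrib_left mult.assoc)
  qed
  ultimately have "w x * (\<Sum>i\<in>UNIV. \<Sum>j\<in>UNIV. ?K i j x *
      iter_deriv (vs @ [axis i 1, axis j 1]) F x) = 0"
    by (simp add: sum_distrib_left)
  then show ?thesis using wpos[OF U(2)] by simp
qed

section \<open>The metric in coordinates\<close>

text \<open>The segment from the identity to \<open>M\<close> consists of positive definite, hence
  invertible, matrices, so the determinant cannot change sign along it.\<close>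

lemma det_pos:
  fixes M :: "real^'n^'n"
  assumes pos: "\<And>v. v \<noteq> 0 \<Longrightarrow> v \<bullet> (M *v v) > 0"
  shows "det M > 0"
proof -
  define H where "H s = (1 - s) *\<^sub>R mat 1 + s *\<^sub>R M" for s :: real
  have Hv: "H s *v v = (1 - s) *\<^sub>R v + s *\<^sub>R (M *v v)" for s v
    by (simp add: H_def matrix_vector_mult_add_rdistrib scaleR_matrix_vector_assoc[symmetric])
  have nz: "det (H s) \<noteq> 0" if "0 \<le> s" "s \<le> 1" for s
  proof
    assume "det (H s) = 0"
    then obtain v where "v \<noteq> 0" "H s *v v = 0"
      using invertible_det_nz[of "H s"] invertible_left_inverse[of "H s"]
        matrix_left_invertible_ker[of "H s"] by auto
    then have "(1 - s) * (v \<bullet> v) + s * (v \<bullet> (M *v v)) = 0"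
      unfolding Hv by (metis inner_add_right inner_scaleR_right inner_zero_right)
    moreover have "(1 - s) * (v \<bullet> v) + s * (v \<bullet> (M *v v)) > 0"
    proof (cases "s = 0")
      case False
      then have "s * (v \<bullet> (M *v v)) > 0" using that pos[OF \<open>v \<noteq> 0\<close>] by simp
      moreover have "(1 - s) * (v \<bullet> v) \<ge> 0" using that by simp
      ultimately show ?thesis by linarith
    qed (use \<open>v \<noteq> 0\<close> in simp)
    ultimately show False by simp
  qed
  have cont: "continuous_on {0..1} (\<lambda>s. det (H s))"
    unfolding det_def H_def by (auto intro!: continuous_intros)
  have "det (H 0) = 1" by (simp add: H_def)
  show ?thesis
  proof (rule ccontr)
    assume "\<not> det M > 0"
    then have "det (H 1) \<le> 0" by (simp add: H_def)
    then obtain s where "0 \<le> s" "s \<le> 1" "det (H s) = 0"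
      using IVT2'[of "\<lambda>s. det (H s)" 1 0 0] cont \<open>det (H 0) = 1\<close> by auto
    then show False using nz by blast
  qed
qed

locale riemannian = manifold X A for X :: "'m topology" and A :: "('m, 'n::finite) chart set" +
  fixes g :: "'m metric"
  assumes inner: "q \<in> topspace X \<Longrightarrow> inner_product_on (tangent_space X A q) (g q)"
    and smooth_metric: "c \<in> A \<Longrightarrow> smooth_on (snd c ` fst c) (\<lambda>y. metric_matrix X A g c y $ i $ j)"
begin

definition metric_form :: "('m, 'n) chart \<Rightarrow> real^'n \<Rightarrow> real^'n \<Rightarrow> real^'n \<Rightarrow> real" where
  "metric_form c x u v = g (param c x) (tvec c x u) (tvec c x v)"

context
  fixes c and x
  assumes c: "c \<in> A" and x: "x \<in> snd c ` fst c"
begin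

private lemma inner_at: "inner_product_on (range (tvec c x)) (g (param c x))"
proof -
  have "param c x \<in> topspace X"
    using openin_subset[OF chart(1)[OF c]] param_in[OF x] by blast
  then show ?thesis
    using inner[of "param c x"] tangent_space_eq[OF c param_in[OF x]] coord_param[OF x] by simp
qed

lemma metric_form_sym: "metric_form c x u v = metric_form c x v u"
  using inner_at unfolding inner_product_on_def metric_form_def by blast

lemma bilinear_metric_form: "bilinear (metric_form c x)"
proof -
  have "linear (\<lambda>u. metric_form c x u v)" for v
  proof
    show "metric_form c x (u + u') v = metric_form c x u v + metric_form c x u' v" for u u'
      using inner_at unfolding inner_product_on_def metric_form_def tvec_linear(1)[OF c x] by blast
    show "metric_form c x (r *\<^sub>R u) v = r *\<^sub>R metric_form c x u v" for r u
      using inner_at unfolding inner_product_on_def metric_form_def tvec_linear(2)[OF c x] by auto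
  qed
  moreover have "metric_form c x u = (\<lambda>v. metric_form c x v u)" for u
    using metric_form_sym by blast
  ultimately show ?thesis unfolding bilinear_def by metis
qed

lemma metric_form_pos: "v \<noteq> 0 \<Longrightarrow> metric_form c x v v > 0"
  using inner_at tvec_nonzero[OF c x] unfolding inner_product_on_def metric_form_def by blast

lemma metric_form_axis: "metric_form c x (axis i 1) v = (metric_matrix X A g c x *v v) $ i"
proof -
  note lin = bilinear_metric_form[unfolded bilinear_def, THEN conjunct1, rule_format, of "axis i 1"]
  have "metric_form c x (axis i 1) (\<Sum>j\<in>UNIV. v $ j *\<^sub>R axis j 1) =
      (\<Sum>j\<in>UNIV. v $ j * metric_form c x (axis i 1) (axis j 1))"
    by (simp add: linear_sum[OF lin] linear_scale[OF lin])
  moreover have "metric_form c x (axis i 1) (axis j 1) = metric_matrix X A g c x $ i $ j" for j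
    by (simp add: metric_form_def metric_matrix_def coord_vec_def velocity_line[OF c x])
  ultimately show ?thesis
    using basis_expansion[of v] by (simp add: matrix_vector_mult_def scalar_mult_eq_scaleR mult.commute)
qed

lemma metric_form_eq_inner: "metric_form c x u v = u \<bullet> (metric_matrix X A g c x *v v)"
proof -
  note lin = bilinear_metric_form[unfolded bilinear_def, THEN conjunct2, rule_format, of v]
  have "metric_form c x (\<Sum>i\<in>UNIV. u $ i *\<^sub>R axis i 1) v =
      (\<Sum>i\<in>UNIV. u $ i * metric_form c x (axis i 1) v)"
    by (simp add: linear_sum[OF lin] linear_scale[OF lin])
  then show ?thesis
    using basis_expansion[of u] by (simp add: metric_form_axis inner_vec_def scalar_mult_eq_scaleR)
qed

lemma det_metric_matrix: "det (metric_matrix X A g c x) > 0"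
  using metric_form_pos by (intro det_pos) (simp add: metric_form_eq_inner)

lemma symmetric_metric_matrix:
  "transpose (metric_matrix X A g c x) = metric_matrix X A g c x"
  unfolding transpose_def vec_eq_iff
  using metric_form_sym by (simp add: metric_matrix_def metric_form_def coord_vec_def velocity_line[OF c x])

text \<open>The two contractions required by \<open>harmonic_form\<close>. The one over the first
  index needs the transpose of \<open>K\<close>, again an inverse because the metric matrix is
  symmetric.\<close>

lemma inverse_metric_matrix:
  fixes v :: "real^'n"
  defines "K \<equiv> matrix_inv (metric_matrix X A g c x)"
  shows "(\<Sum>j\<in>UNIV. K $ i $ j * metric_form c x (axis j 1) v) = v $ i"
    and "(\<Sum>i\<in>UNIV. K $ i $ j * metric_form c x (axis i 1) v) = v $ j"
proof -
  let ?G = "metric_matrix X A g c x"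
  have K: "?G ** K = mat 1" "K ** ?G = mat 1"
    using det_metric_matrix unfolding K_def by (auto intro!: matrix_inv_mult)
  have "transpose K ** ?G = transpose (?G ** K)"
    by (simp add: matrix_transpose_mul symmetric_metric_matrix)
  then have "transpose K ** ?G = mat 1" by (simp add: K(1) transpose_mat)
  have row: "(K *v y) $ i = (\<Sum>j\<in>UNIV. K $ i $ j * y $ j)"
    "(transpose K *v y) $ j = (\<Sum>i\<in>UNIV. K $ i $ j * y $ i)" for y i j
    by (simp_all only: matrix_vector_mult_def transpose_def vec_lambda_beta)
  from \<open>transpose K ** ?G = mat 1\<close> have "transpose K *v (?G *v v) = v" "K *v (?G *v v) = v"
    by (simp_all add: matrix_vector_mul_assoc K)
  then show "(\<Sum>j\<in>UNIV. K $ i $ j * metric_form c x (axis j 1) v) = v $ i"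
    and "(\<Sum>i\<in>UNIV. K $ i $ j * metric_form c x (axis i 1) v) = v $ j"
    unfolding metric_form_axis row[symmetric] by simp_all
qed

end

section \<open>The leading form of an eigenfunction: harmonicity and zeros\<close>

lemma smooth_eigenfunction:
  assumes "laplace_eigenfunction X A g lam f" and "c \<in> A"
  shows "smooth_on (snd c ` fst c) (f \<circ> param c)"
proof -
  have "fst c \<inter> topspace X = fst c" using openin_subset[OF chart(1)[OF assms(2)]] by blast
  then show ?thesis
    using assms unfolding laplace_eigenfunction_def smooth_fun_on_def by metis
qed

context
  fixes f :: "'m \<Rightarrow> real" and lam :: real and c and p and n :: nat
  assumes eigen: "laplace_eigenfunction X A g lam f" and c: "c \<in> A" and p: "p \<in> fst c"
    and low: "\<And>j h. j < n \<Longrightarrow> taylor_term j (f \<circ> param c) (snd c p) h = 0"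
begin

private lemma x: "snd c p \<in> snd c ` fst c" using p by blast

private lemmas jet_facts = chart(2)[OF c] smooth_eigenfunction[OF eigen c] x

lemma low_replicate: "j < n \<Longrightarrow> iter_deriv (replicate j h) (f \<circ> param c) (snd c p) = 0"
  using low[of j h] taylor_term_eq_iter_deriv[OF jet_facts, of j h] by simp

text \<open>Taylor terms control only repeated directions; polarization over the whole space yields
  the mixed derivatives.\<close>

lemma low_derivatives:
  assumes "length vs < n"
  shows "iter_deriv vs (f \<circ> param c) (snd c p) = 0"
proof -
  interpret symmetric_multilinear "jet (f \<circ> param c) (snd c p)"
    by (rule symmetric_multilinear_jet[OF jet_facts])
  have "jet (f \<circ> param c) (snd c p) (mset vs + {#}) = 0"
  proof (rule polarization[OF subspace_UNIV])
    show "jet (f \<circ> param c) (snd c p) (replicate_mset (size (mset vs)) h + {#}) = 0" for h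
      using low_replicate[OF assms] by (simp add: jet_replicate[OF jet_facts])
  qed simp
  then show ?thesis by (simp add: jet_mset[OF jet_facts])
qed

lemma harmonic_form_eigenfunction:
  "harmonic_form (jet (f \<circ> param c) (snd c p)) (metric_form c (snd c p))
    (matrix_inv (metric_matrix X A g c (snd c p))) n"
proof -
  interpret symmetric_multilinear "jet (f \<circ> param c) (snd c p)"
    by (rule symmetric_multilinear_jet[OF jet_facts])
  let ?F = "f \<circ> param c" and ?x = "snd c p" and ?G = "metric_matrix X A g c"
  have pde: "(\<Sum>i\<in>UNIV. partial i (\<lambda>y. sqrt (det (?G y)) *
      (\<Sum>j\<in>UNIV. matrix_inv (?G y) $ i $ j * partial j ?F y)) y) / sqrt (det (?G y)) = - lam * ?F y"
    if y: "y \<in> snd c ` fst c" for y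
  proof -
    have "- lam * f (param c y) = laplacian_in_chart X A g c f (snd c (param c y))"
      using eigen c param_in[OF y] unfolding laplace_eigenfunction_def has_laplacian_def by blast
    then show ?thesis
      by (simp add: laplacian_in_chart_def coord_param[OF y] Let_def)
  qed
  show ?thesis
  proof
    show "bilinear (metric_form c ?x)" by (rule bilinear_metric_form[OF c x])
    show "metric_form c ?x u v = metric_form c ?x v u" for u v by (rule metric_form_sym[OF c x])
    fix v :: "real^'n" and i j :: 'n
    show "(\<Sum>i\<in>UNIV. matrix_inv (?G ?x) $ i $ j * metric_form c ?x (axis i 1) v) = v $ j"
      by (rule inverse_metric_matrix(2)[OF c x])
    show "(\<Sum>j\<in>UNIV. matrix_inv (?G ?x) $ i $ j * metric_form c ?x (axis j 1) v) = v $ i"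
      by (rule inverse_metric_matrix(1)[OF c x])
  next
    fix N :: "(real^'n) multiset" assume N: "size N + 2 = n"
    obtain vs where vs: "N = mset vs" using ex_mset by metis
    have "jet ?F ?x ({#axis i 1, axis j 1#} + N) = iter_deriv (vs @ [axis i 1, axis j 1]) ?F ?x" for i j
      using jet_mset[OF jet_facts, of "vs @ [axis i 1, axis j 1]"] by (simp add: vs)
    moreover have "(\<Sum>i\<in>UNIV. \<Sum>j\<in>UNIV. matrix_inv (?G ?x) $ i $ j *
        iter_deriv (vs @ [axis i 1, axis j 1]) ?F ?x) = 0"
      by (rule leading_part_harmonic[OF jet_facts(1,3,2) smooth_metric[OF c] det_metric_matrix[OF c] pde
            low_derivatives])
        (use N vs in auto)
    ultimately show "(\<Sum>i\<in>UNIV. \<Sum>j\<in>UNIV. matrix_inv (?G ?x) $ i $ j *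
        jet ?F ?x ({#axis i 1, axis j 1#} + N)) = 0" by simp
  qed
qed

text \<open>The linear form \<open>metric_form c (snd c p) e\<close> kills the tangent vectors of
  \<open>N\<close> and is 1 at e. Hence \<open>hypersurface_curve\<close> realises h as the velocity
  of a curve in \<open>N\<close>, along which f vanishes.\<close>

lemma leading_term_zero_on_tangent:
  assumes N: "nodal_hypersurface X A f N" and "p \<in> N"
    and normal: "unit_normal X A g N p (tvec c (snd c p) e)"
    and h: "metric_form c (snd c p) e h = 0"
  shows "jet (f \<circ> param c) (snd c p) (replicate_mset n h) = 0"
proof -
  have p': "param c (snd c p) = p" using c p param_coord by blast
  have unit: "metric_form c (snd c p) e e = 1"
    and orth: "\<And>v. tvec c (snd c p) v \<in> tangent_space_of X A N p \<Longrightarrow> metric_form c (snd c p) e v = 0"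
    using normal unfolding unit_normal_def metric_form_def p' by auto
  have lin: "linear (metric_form c (snd c p) e)"
    using bilinear_metric_form[OF c x] unfolding bilinear_def by blast
  obtain \<gamma> where \<gamma>: "\<gamma> 0 = snd c p" "(\<gamma> has_vector_derivative h) (at 0)"
    and near: "eventually (\<lambda>t. \<gamma> t \<in> snd c ` (fst c \<inter> N)) (nhds 0)"
    by (rule hypersurface_curve[OF _ \<open>p \<in> N\<close> c p lin, where e = e and h = h, OF _ _ h orth])
      (use N unit in \<open>auto simp: nodal_hypersurface_def\<close>)
  have "eventually (\<lambda>t. (f \<circ> param c) (\<gamma> t) = 0) (nhds 0)"
    using near
  proof eventually_elim
    case (elim t)
    then obtain q where "q \<in> fst c" "q \<in> N" "\<gamma> t = snd c q" by blast
    then show ?case using N param_coord[OF c] by (auto simp: nodal_hypersurface_def)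
  qed
  then have "eventually (\<lambda>t. (f \<circ> param c) (\<gamma> t) = 0) (at_right 0)"
    by (simp add: eventually_at_filter eventually_mono)
  with jet_facts low_replicate \<gamma> have "iter_deriv (replicate n h) (f \<circ> param c) (snd c p) = 0"
    by (rule leading_term_zero_along_curve)
  then show ?thesis by (simp only: jet_replicate[OF jet_facts])
qed

end

end

section \<open>The angle between two nodal hypersurfaces\<close>

theorem theorem1p12:
  fixes X :: "'m topology" and A :: "('m, 'n::finite) chart set" and g :: "'m metric"
    and f :: "'m \<Rightarrow> real" and lam :: real and M1 M2 :: "'m set" and p :: 'm
    and \<eta>1 \<eta>2 :: "'m tvec" and n0 :: nat
  assumes "compact_space X" and "riemannian_manifold X A g" and "CARD('n) \<ge> 3"
    and "laplace_eigenfunction X A g lam f"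
    and "nodal_hypersurface X A f M1" and "nodal_hypersurface X A f M2"
    and "p \<in> M1 \<inter> M2"
    and "unit_normal X A g M1 p \<eta>1" and "unit_normal X A g M2 p \<eta>2"
    and "vanishing_order A f p n0"
  shows "arccos (g p \<eta>1 \<eta>2) \<in> {real a / real b * pi | a b. b \<in> {1..n0} \<and> a \<in> {0..b}}"
proof -
  interpret riemannian X A g
    using assms(2) by unfold_locales (auto simp: riemannian_manifold_def)
  obtain c h0 where c: "c \<in> A" "p \<in> fst c"
    and h0: "taylor_term n0 (f \<circ> param c) (snd c p) h0 \<noteq> 0"
    and low: "\<And>j h. j < n0 \<Longrightarrow> taylor_term j (f \<circ> param c) (snd c p) h = 0"
    using assms(10) unfolding vanishing_order_def by blast
  let ?x = "snd c p" and ?b = "metric_form c (snd c p)"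
  have x: "?x \<in> snd c ` fst c" "param c ?x = p" using c param_coord by auto
  obtain e1 e2 where e: "\<eta>1 = tvec c ?x e1" "\<eta>2 = tvec c ?x e2"
    using assms(8,9) tangent_space_eq[OF c] unfolding unit_normal_def by auto
  have unit: "?b e1 e1 = 1" "?b e2 e2 = 1"
    using assms(8,9) unfolding unit_normal_def metric_form_def x(2) e by auto
  have angle: "g p \<eta>1 \<eta>2 = ?b e1 e2" unfolding metric_form_def x(2) e ..
  interpret H: harmonic_form "jet (f \<circ> param c) ?x" ?b "matrix_inv (metric_matrix X A g c ?x)" n0
    by (rule harmonic_form_eigenfunction[OF assms(4) c low])
  note jet_facts = chart(2)[OF c(1)] smooth_eigenfunction[OF assms(4) c(1)] x(1)
  have nz: "jet (f \<circ> param c) ?x (replicate_mset n0 h0) \<noteq> 0"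
    using h0 by (simp add: taylor_term_eq_iter_deriv[OF jet_facts] jet_replicate[OF jet_facts])
  have "n0 \<noteq> 0"
  proof
    assume "n0 = 0"
    then have "f p \<noteq> 0" using h0 x(2) by (simp add: taylor_term_def)
    then show False using assms(5,7) unfolding nodal_hypersurface_def by blast
  qed
  \<comment> \<open>Cauchy-Schwarz for unit vectors: positivity at e2 - t e1, whose squared length
    is 1 - t^2.\<close>
  define t where "t = ?b e1 e2"
  have "?b (e2 - t *\<^sub>R e1) (e2 - t *\<^sub>R e1) = 1 - t\<^sup>2"
    using unit H.sym[of e2 e1]
    by (simp add: bilinear_lsub[OF H.bilin] bilinear_rsub[OF H.bilin] bilinear_lmul[OF H.bilin]
        bilinear_rmul[OF H.bilin] t_def power2_eq_square)
  moreover have "?b v v \<ge> 0" for v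
    using metric_form_pos[OF c(1) x(1), of v] bilinear_lzero[OF H.bilin]
    by (cases "v = 0") (auto simp: less_imp_le)
  ultimately have "t\<^sup>2 \<le> 1" by (metis diff_ge_0_iff_ge)
  then have "\<bar>t\<bar> \<le> 1" by (simp add: abs_square_le_1)
  \<comment> \<open>If t is 1 or -1 the tangent hyperplanes coincide, and the angle is 0 or pi, a
    fraction with denominator 1.\<close>
  then consider "t = 1" | "t = - 1" | "\<bar>t\<bar> < 1" by linarith
  then have "\<exists>m\<in>{1..n0}. \<exists>a\<in>{0..m}. arccos t = real a / real m * pi"
  proof cases
    case 1
    then show ?thesis using \<open>n0 \<noteq> 0\<close> by (intro bexI[of _ 1] bexI[of _ 0]) auto
  next
    case 2
    then show ?thesis using \<open>n0 \<noteq> 0\<close> by (intro bexI[of _ 1] bexI[of _ 1]) auto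
  next
    case 3
    then show ?thesis
      unfolding t_def
      using H.angle[OF unit _ nz]
        leading_term_zero_on_tangent[OF assms(4) c low assms(5) _ assms(8)[unfolded e]]
        leading_term_zero_on_tangent[OF assms(4) c low assms(6) _ assms(9)[unfolded e]] assms(7)
      by blast
  qed
  then show ?thesis unfolding angle t_def[symmetric] by blast
qed

end
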